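(* Let $s=(s_1,\dots,s_n)$ be a composition and let $\mathcal T$ be the Danilov–Karzanov–Koshevoy triangulation of the flow polytope $\mathcal F_{G_s}$ of the framed $s$-oruga graph $(G_s,\preceq)$. Then the map $(w,A)\mapsto \Delta_{(w,A)}$ is a poset isomorphism from the face poset of the combinatorial $s$-permutahedron onto the set of interior simplices of $\mathcal T$ (simplices not contained in the boundary of $\mathcal F_{G_s}$), ordered by reverse inclusion.
   Context: $s=(s_1,\dots,s_n)$ is a composition (all $s_i$ positive integers), $|s|=\sum_i s_i$. A Stirling $s$-permutation is a word in which each $i\in[n]$ occurs exactly $s_i$ times and which avoids the pattern $121$ (there are no $i<j$ with an occurrence of $j$ between two occurrences of $i$); $\mathcal W_s$ is the set of them. For a word $w$, $w_{[i]}$ is its prefix of length $i$ ($w_{[0]}$ is empty). The $a$-block $B_a$ of $w$ is the shortest consecutive substring of $w$ containing all occurrences of $a$. For $1\le a<c\le n$, $(a,c)$ is an ascent of $w$ if $ac$ is a consecutive substring of $w$ (equivalently $w=u_1B_acu_2$), and the transposition of $w=u_1B_acu_2$ along this ascent is $u_1cB_au_2\in\mathcal W_s$. For $a<c$ let $\#_w(c,a)$ be the number of occurrences of $c$ preceding the $a$-block. The $s$-weak order: $w\le w'$ iff $\#_w(c,a)\le\#_{w'}(c,a)$ for all $a<c$. For a set $A$ of ascents of $w$, $w+A$ is the Stirling $s$-permutation whose inversion numbers form the pointwise smallest function $I$ on pairs $a<c$ with $I(c,a)\ge \#_w(c,a)+[(a,c)\in A]$ that is transitive (for all $a<b<c$: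 $I(b,a)=0$ or $I(c,a)\ge I(c,b)$). The combinatorial $s$-permutahedron has faces the pairs $(w,A)$ with $w\in\mathcal W_s$ and $A$ a set of ascents of $w$, with $(w,A)\le(w',A')$ iff $[w,w+A]\subseteq[w',w'+A']$ as intervals of the $s$-weak order. Graph: put $s_{n+1}=2$. $G_s$ has vertices $v_{-1},v_0,\dots,v_n$; for each $i\in[1,n+1]$ there are $s_i-1$ source-edges $e^i_1,\dots,e^i_{s_i-1}$ from $v_{-1}$ to $v_{n+1-i}$; for each $i\in[1,n]$ there are two edges $e^i_0$ (bump) and $e^i_{s_i}$ (dip) from $v_{n-i}$ to $v_{n+1-i}$. Routes are directed paths $v_{-1}\to v_n$; they are exactly $R(k,t,\delta)=(e^k_t,e^{k-1}_{\delta_{k-1}s_{k-1}},\dots,e^1_{\delta_1s_1})$ for $k\in[1,n+1]$, $t\in[1,s_k-1]$, $\delta\in\{0,1\}^{k-1}$. $\mathcal F_{G_s}\subset\mathbb R^E$ is the set of $f\in\mathbb R^E_{\ge0}$ with (outflow $-$ inflow) equal to $1$ at $v_{-1}$, $-1$ at $v_n$ and $0$ elsewhere; its vertices are the indicator vectors $\chi_R$ of routes. Framing: at $v_{n+1-i}$ ($i\in[1,n]$) the incoming edges are ordered $e^i_0\prec e^i_1\prec\dots\prec e^i_{s_i}$, and the outgoing edges of $v_{n+1-i}$ ($i\in[2,n]$) are ordered $e^{i-1}_0\prec e^{i-1}_{s_{i-1}}$. For routes $P,Q$ through a vertex $v$ with different initial parts $Pv\ne Qv$, let $v_j$ be the vertex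 nearest to $v$ such that $Pv,Qv$ agree from $v_j$ to $v$ but enter $v_j$ by different edges; $Pv\prec Qv$ if $P$'s edge entering $v_j$ precedes $Q$'s. Symmetrically for final parts $vP,vQ$ using the last divergence vertex after $v$ and the outgoing order there. $P,Q$ are coherent if for every maximal common subpath from $v_i$ to $v_j$ ($v_i,v_j$ inner vertices, possibly equal) the comparisons of $Pv_i,Qv_i$ and of $v_jP,v_jQ$ agree. A clique is a set of pairwise coherent routes; the simplices $\mathrm{conv}\{\chi_R:R\in C\}$ over cliques $C$ form a triangulation $\mathcal T$ of $\mathcal F_{G_s}$ (DKK triangulation); a clique is identified with its simplex. For a prefix $u$ of a Stirling $s$-permutation let $t_a=t_a(u)$ be the number of occurrences of $a$ in $u$, let $c$ be the smallest $a\in[n]$ with $0<t_a<s_a$ (if none, $c=n+1$ and $t_{n+1}=1$), and $\mathrm{route}(u)=(e^c_{t_c},e^{c-1}_{t_{c-1}},\dots,e^1_{t_1})$. Set $\Delta_w=\{\mathrm{route}(w_{[i]}):0\le i\le|s|\}$. For a face $(w,A)$, $\Delta_{(w,A)}=\Delta_w$ if $A=\emptyset$, and otherwise $\Delta_{(w,A)}=\bigcap_{(a,c)\in A}(\Delta_w\cap\Delta_{w'_{(a,c)}})$ where $w'_{(a,c)}$ is the transposition of $w$ along $(a,c)$. *)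

theory Defs
  imports
    "HOL-Analysis.Analysis"
    "HOL-Analysis.Finite_Function_Topology"
    "HOL-Library.Sublist"
    "Graph_Theory.Arc_Walk"
begin

subsection \<open>Stirling permutations and the weak order\<close>

definition composition :: "nat list \<Rightarrow> bool" where
  "composition s \<longleftrightarrow> (\<forall>x\<in>set s. 0 < x)"

text \<open>Parts are indexed from 1, and the part after the last one is set to 2.\<close>

definition part :: "nat list \<Rightarrow> nat \<Rightarrow> nat" where
  "part s i = (s @ [2]) ! (i - 1)"

definition stirling :: "nat list \<Rightarrow> nat list set" where
  "stirling s = {w. set w \<subseteq> {1..length s} \<and>
     (\<forall>i\<in>{1..length s}. count_list w i = part s i) \<and>
     \<not> (\<exists>p q r. p < q \<and> q < r \<and> r < length w \<and> w ! p = w ! r \<and> w ! p < w ! q)}"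

text \<open>\<open>block w a u B v\<close>: the word \<open>w\<close> is \<open>u B v\<close> with \<open>B\<close> the \<open>a\<close>-block of \<open>w\<close>.\<close>

definition block :: "nat list \<Rightarrow> nat \<Rightarrow> nat list \<Rightarrow> nat list \<Rightarrow> nat list \<Rightarrow> bool" where
  "block w a u B v \<longleftrightarrow> w = u @ B @ v \<and> count_list B a = count_list w a \<and>
     (\<forall>u' B' v'. w = u' @ B' @ v' \<and> count_list B' a = count_list w a \<longrightarrow> length B \<le> length B')"

definition ascents :: "nat list \<Rightarrow> (nat \<times> nat) set" where
  "ascents w = {(a, c). a < c \<and> sublist [a, c] w}"

definition transposition :: "nat list \<Rightarrow> nat \<Rightarrow> nat \<Rightarrow> nat list" where
  "transposition w a c =
     (THE w'. \<exists>u B v. block w a u B (c # v) \<and> w' = u @ [c] @ B @ v)"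

definition inv_num :: "nat list \<Rightarrow> nat \<Rightarrow> nat \<Rightarrow> nat" where
  "inv_num w c a = (THE k. \<exists>u B v. block w a u B v \<and> k = count_list u c)"

definition weak_le :: "nat list \<Rightarrow> nat list \<Rightarrow> nat list \<Rightarrow> bool" where
  "weak_le s w w' \<longleftrightarrow>
     (\<forall>a c. 1 \<le> a \<and> a < c \<and> c \<le> length s \<longrightarrow> inv_num w c a \<le> inv_num w' c a)"

definition weak_interval :: "nat list \<Rightarrow> nat list \<Rightarrow> nat list \<Rightarrow> nat list set" where
  "weak_interval s w w' = {z \<in> stirling s. weak_le s w z \<and> weak_le s z w'}"

definition transitive_above ::
    "nat list \<Rightarrow> nat list \<Rightarrow> (nat \<times> nat) set \<Rightarrow> (nat \<Rightarrow> nat \<Rightarrow> nat) \<Rightarrow> bool" where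
  "transitive_above s w A I \<longleftrightarrow>
     (\<forall>a c. 1 \<le> a \<and> a < c \<and> c \<le> length s \<longrightarrow>
        inv_num w c a + of_bool ((a, c) \<in> A) \<le> I c a) \<and>
     (\<forall>a b c. 1 \<le> a \<and> a < b \<and> b < c \<and> c \<le> length s \<longrightarrow> I b a = 0 \<or> I c b \<le> I c a)"

definition add_ascents :: "nat list \<Rightarrow> nat list \<Rightarrow> (nat \<times> nat) set \<Rightarrow> nat list" where
  "add_ascents s w A = (THE w'. w' \<in> stirling s \<and> transitive_above s w A (inv_num w') \<and>
     (\<forall>I. transitive_above s w A I \<longrightarrow>
        (\<forall>a c. 1 \<le> a \<and> a < c \<and> c \<le> length s \<longrightarrow> inv_num w' c a \<le> I c a)))"

definition perm_faces :: "nat list \<Rightarrow> (nat list \<times> (nat \<times> nat) set) set" where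
  "perm_faces s = {(w, A). w \<in> stirling s \<and> A \<subseteq> ascents w}"

definition face_le ::
    "nat list \<Rightarrow> nat list \<times> (nat \<times> nat) set \<Rightarrow> nat list \<times> (nat \<times> nat) set \<Rightarrow> bool" where
  "face_le s = (\<lambda>(w, A) (w', A').
     weak_interval s w (add_ascents s w A) \<subseteq> weak_interval s w' (add_ascents s w' A'))"

subsection \<open>The framed oruga graph and its flow polytope\<close>

text \<open>The vertex \<open>v\<^sub>j\<close> is the integer \<open>j\<close>, and the edge with upper index \<open>i\<close> and lower
  index \<open>t\<close> is the pair \<open>(i, t)\<close>; it is a source-edge iff \<open>0 < t < s\<^sub>i\<close>.\<close>

definition oruga :: "nat list \<Rightarrow> (int, nat \<times> nat) pre_digraph" where
  "oruga s = \<lparr>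
     verts = {-1..int (length s)},
     arcs = {(i, t). 1 \<le> i \<and> i \<le> length s + 1 \<and> 1 \<le> t \<and> t \<le> part s i - 1} \<union>
            {(i, t). 1 \<le> i \<and> i \<le> length s \<and> (t = 0 \<or> t = part s i)},
     tail = (\<lambda>(i, t). if 0 < t \<and> t < part s i then -1 else int (length s) - int i),
     head = (\<lambda>(i, t). int (length s) + 1 - int i)\<rparr>"

definition inner :: "nat list \<Rightarrow> int set" where
  "inner s = {0..<int (length s)}"

definition routes :: "nat list \<Rightarrow> (nat \<times> nat) list set" where
  "routes s = {P. pre_digraph.apath (oruga s) (-1) P (int (length s))}"

text \<open>The space of real functions on the edges is the subspace of those finitely supported
  functions whose support consists of edges.\<close>

definition flow_polytope :: "nat list \<Rightarrow> ((nat \<times> nat) \<Rightarrow>\<^sub>0 real) set" where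
  "flow_polytope s = {f. Poly_Mapping.keys f \<subseteq> arcs (oruga s) \<and>
     (\<forall>e\<in>arcs (oruga s). 0 \<le> Poly_Mapping.lookup f e) \<and>
     (\<forall>v\<in>verts (oruga s).
        (\<Sum>e\<in>out_arcs (oruga s) v. Poly_Mapping.lookup f e) -
        (\<Sum>e\<in>in_arcs (oruga s) v. Poly_Mapping.lookup f e) =
        (if v = -1 then 1 else if v = int (length s) then -1 else 0))}"

definition route_indicator :: "(nat \<times> nat) list \<Rightarrow> ((nat \<times> nat) \<Rightarrow>\<^sub>0 real)" where
  "route_indicator R = (\<Sum>e\<in>set R. Poly_Mapping.single e 1)"

definition in_prec :: "nat list \<Rightarrow> nat \<times> nat \<Rightarrow> nat \<times> nat \<Rightarrow> bool" where
  "in_prec s e f \<longleftrightarrow> head (oruga s) e = head (oruga s) f \<and> snd e < snd f"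

definition out_prec :: "nat list \<Rightarrow> nat \<times> nat \<Rightarrow> nat \<times> nat \<Rightarrow> bool" where
  "out_prec s e f \<longleftrightarrow>
     tail (oruga s) e = tail (oruga s) f \<and> tail (oruga s) e \<noteq> -1 \<and> snd e < snd f"

text \<open>Comparison of two paths ending, respectively starting, at a common vertex.
  Since \<open>e \<noteq> f\<close>, the list \<open>r\<close> is the longest common suffix, respectively prefix.\<close>

definition initial_prec ::
    "nat list \<Rightarrow> (nat \<times> nat) list \<Rightarrow> (nat \<times> nat) list \<Rightarrow> bool" where
  "initial_prec s p q \<longleftrightarrow>
     (\<exists>x y e f r. p = x @ [e] @ r \<and> q = y @ [f] @ r \<and> in_prec s e f)"

definition final_prec ::
    "nat list \<Rightarrow> (nat \<times> nat) list \<Rightarrow> (nat \<times> nat) list \<Rightarrow> bool" where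
  "final_prec s p q \<longleftrightarrow>
     (\<exists>x y e f r. p = r @ [e] @ x \<and> q = r @ [f] @ y \<and> out_prec s e f)"

text \<open>In the following, \<open>m\<close> is a common subpath from \<open>u\<close> to \<open>v\<close>, which is maximal iff the
  routes enter \<open>u\<close> by different edges and leave \<open>v\<close> by different edges. It may be empty, in
  which case \<open>u = v\<close>.\<close>

definition coherent :: "nat list \<Rightarrow> (nat \<times> nat) list \<Rightarrow> (nat \<times> nat) list \<Rightarrow> bool" where
  "coherent s P Q \<longleftrightarrow>
     (\<forall>u\<in>inner s. \<forall>v\<in>inner s. \<forall>p q m p' q'.
        P = p @ m @ p' \<and> Q = q @ m @ q' \<and>
        pre_digraph.awalk (oruga s) (-1) p u \<and> pre_digraph.awalk (oruga s) (-1) q u \<and>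
        pre_digraph.awalk (oruga s) u m v \<and> last p \<noteq> last q \<and> hd p' \<noteq> hd q' \<longrightarrow>
        (initial_prec s p q \<longleftrightarrow> final_prec s p' q'))"

definition clique :: "nat list \<Rightarrow> (nat \<times> nat) list set \<Rightarrow> bool" where
  "clique s C \<longleftrightarrow> C \<subseteq> routes s \<and> (\<forall>P\<in>C. \<forall>Q\<in>C. coherent s P Q)"

definition route_simplex :: "(nat \<times> nat) list set \<Rightarrow> ((nat \<times> nat) \<Rightarrow>\<^sub>0 real) set" where
  "route_simplex C = convex hull (route_indicator ` C)"

definition dkk_triangulation :: "nat list \<Rightarrow> ((nat \<times> nat) \<Rightarrow>\<^sub>0 real) set set" where
  "dkk_triangulation s = {route_simplex C | C. clique s C}"

definition interior_simplices :: "nat list \<Rightarrow> ((nat \<times> nat) \<Rightarrow>\<^sub>0 real) set set" where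
  "interior_simplices s =
     {\<sigma> \<in> dkk_triangulation s. \<not> \<sigma> \<subseteq> rel_frontier (flow_polytope s)}"

subsection \<open>The cliques attached to faces\<close>

definition route_level :: "nat list \<Rightarrow> nat list \<Rightarrow> nat" where
  "route_level s u =
     (if \<exists>a\<in>{1..length s}. 0 < count_list u a \<and> count_list u a < part s a
      then LEAST a. a \<in> {1..length s} \<and> 0 < count_list u a \<and> count_list u a < part s a
      else length s + 1)"

definition route_of :: "nat list \<Rightarrow> nat list \<Rightarrow> (nat \<times> nat) list" where
  "route_of s u =
     (let c = route_level s u
      in (c, if c = length s + 1 then 1 else count_list u c) #
         map (\<lambda>a. (a, count_list u a)) (rev [1..<c]))"

definition Delta_word :: "nat list \<Rightarrow> nat list \<Rightarrow> (nat \<times> nat) list set" where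
  "Delta_word s w = {route_of s (take i w) | i. i \<le> sum_list s}"

definition Delta_face ::
    "nat list \<Rightarrow> nat list \<times> (nat \<times> nat) set \<Rightarrow> (nat \<times> nat) list set" where
  "Delta_face s = (\<lambda>(w, A).
     if A = {} then Delta_word s w
     else (\<Inter>(a, c)\<in>A. Delta_word s w \<inter> Delta_word s (transposition w a c)))"

end

theory Submission
  imports Defs
begin

text \<open>
  A route is recorded by the numbers \<open>R(a)\<close> with \<open>(a, R(a))\<close> an edge of \<open>R\<close>. Two routes are
  coherent iff these numbers are componentwise comparable where both are defined, and the simplex of
  a clique is interior iff the clique covers every edge. A route \<open>R\<close> lies in \<open>\<Delta>\<^sub>w\<close> iff for all
  \<open>a < c\<close> the inversion number \<open>#\<^sub>w(c, a)\<close> is at least \<open>R(c)\<close> when \<open>R(a) = 0\<close> and at most \<open>R(c)\<close>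
  when \<open>R(a) = s\<^sub>a\<close>. Hence a covering clique \<open>C\<close> confines the inversion numbers of the words \<open>w\<close>
  with \<open>C \<subseteq> \<Delta>\<^sub>w\<close> between \<open>L(c, a) = max {R(c) | R(a) = 0}\<close> and \<open>U(c, a) = min {R(c) | R(a) = s\<^sub>a}\<close>.
  Both functions satisfy the conditions that characterise inversion numbers of Stirling
  permutations. If \<open>C\<close> comes from the face \<open>(w, A)\<close>, they belong to \<open>w\<close> and \<open>w + A\<close>, and \<open>C\<close> arises
  from \<open>\<Delta>\<^sub>w\<close> by deleting the routes of the prefixes that end at an ascent in \<open>A\<close>. So inclusion of
  intervals is reverse inclusion of cliques.
\<close>

subsection \<open>Words avoiding the pattern 121\<close>

text \<open>For a < b < c, the conditions that make I an inversion function are I(c,a) \<le> s_c;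
  transitivity, I(c,b) \<le> I(c,a) if I(b,a) > 0; and planarity, I(c,a) \<le> I(c,b) if I(b,a) <
  s_b. The last two place the a-block after the first b, or before the last b. The same squeeze
  decides when prescribed letter counts are those of one prefix, which serves both to build words
  and to recognise the routes of a word.

  Coverage alone does not say that a given prefix route is in C; it supplies, for every letter and
  count, some prefix with that count. Between two equal letters this fixes the position. At a
  descent the smaller letter has not begun, and a route attaining L fixes the position. At an ascent
  nothing is forced, which is the freedom to choose A.

  That U is the least transitive function above w and A takes an induction on c - a: the prefix
  ending with the a-block may have been deleted, or may hide c behind a smaller letter that is only
  partly used.\<close>

definition avoids_121 :: "nat list \<Rightarrow> bool" where
  "avoids_121 w \<longleftrightarrow> (\<forall>u y v x. w = u @ y # v \<longrightarrow> x \<in> set u \<longrightarrow> x \<in> set v \<longrightarrow> y \<le> x)"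

text \<open>Computable form of \<open>inv_num\<close>, a definite description over blocks. The two
  agree when a occurs in the word, because the a-block starts at the first a.\<close>

definition inversions :: "nat list \<Rightarrow> nat \<Rightarrow> nat \<Rightarrow> nat" where
  "inversions w c a = count_list (takeWhile (\<lambda>x. x \<noteq> a) w) c"

lemma avoids_121_iff_nth:
  "avoids_121 w \<longleftrightarrow>
    \<not> (\<exists>p q r. p < q \<and> q < r \<and> r < length w \<and> w ! p = w ! r \<and> w ! p < w ! q)"
proof
  assume av: "avoids_121 w"
  show "\<not> (\<exists>p q r. p < q \<and> q < r \<and> r < length w \<and> w ! p = w ! r \<and> w ! p < w ! q)"
  proof clarify
    fix p q r
    assume h: "p < q" "q < r" "r < length w" "w ! p = w ! r" "w ! p < w ! q"
    have "w = take q w @ w ! q # drop (Suc q) w"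
      using h by (simp add: id_take_nth_drop)
    moreover have "w ! p \<in> set (take q w)"
      using h by (auto simp: in_set_conv_nth intro!: exI[of _ p])
    moreover have "w ! p \<in> set (drop (Suc q) w)"
      using h by (auto simp: in_set_conv_nth intro!: exI[of _ "r - Suc q"])
    ultimately have "w ! q \<le> w ! p"
      using av unfolding avoids_121_def by blast
    with h show False by simp
  qed
next
  assume h: "\<not> (\<exists>p q r. p < q \<and> q < r \<and> r < length w \<and> w ! p = w ! r \<and> w ! p < w ! q)"
  show "avoids_121 w"
    unfolding avoids_121_def
  proof (intro allI impI)
    fix u y v x
    assume w: "w = u @ y # v" and xu: "x \<in> set u" and xv: "x \<in> set v"
    obtain p where p: "p < length u" "u ! p = x"
      using xu by (auto simp: in_set_conv_nth)
    obtain r where r: "r < length v" "v ! r = x"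
      using xv by (auto simp: in_set_conv_nth)
    show "y \<le> x"
    proof (rule ccontr)
      assume "\<not> y \<le> x"
      then have "p < length u \<and> length u < Suc (length u + r) \<and> Suc (length u + r) < length w \<and>
          w ! p = w ! Suc (length u + r) \<and> w ! p < w ! length u"
        using p r w by (auto simp: nth_append)
      with h show False by blast
    qed
  qed
qed

section \<open>Letter counts of prefixes against inversion numbers\<close>

lemma count_list_pos_iff: "0 < count_list w a \<longleftrightarrow> a \<in> set w"
  using count_list_0_iff[of w a] by auto

lemma count_list_take_mono: "i \<le> j \<Longrightarrow> count_list (take i w) a \<le> count_list (take j w) a"
  by (metis count_list_append le_add1 le_add_diff_inverse take_add)

lemma count_list_take_le: "count_list (take i w) a \<le> count_list w a"
  by (metis append_take_drop_id count_list_append le_add1)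

lemma count_list_take_Suc:
  "i < length w \<Longrightarrow>
    count_list (take (Suc i) w) a = count_list (take i w) a + (if w ! i = a then 1 else 0)"
  by (simp add: take_Suc_conv_app_nth)

lemma count_list_take_less: "i < length w \<Longrightarrow> w ! i = a \<Longrightarrow> count_list (take i w) a < count_list w a"
  using count_list_take_Suc[of i w a] count_list_take_le[of "Suc i" w a] by simp

lemma count_list_take_nth:
  assumes "0 < t" "t \<le> count_list w a"
  obtains i where "i < length w" "w ! i = a" "count_list (take (Suc i) w) a = t"
proof -
  define m where "m = (LEAST i. t \<le> count_list (take i w) a)"
  have m: "t \<le> count_list (take m w) a"
    unfolding m_def by (rule LeastI[of _ "length w"]) (use assms in simp)
  with assms obtain i where i: "m = Suc i" by (cases m) auto
  have lt: "count_list (take i w) a < t"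
    using not_less_Least[of i "\<lambda>i. t \<le> count_list (take i w) a"] i unfolding m_def by auto
  have "i < length w"
    using lt m i by (metis not_le take_all le_SucI)
  with lt m i have "w ! i = a \<and> count_list (take (Suc i) w) a = t"
    by (auto simp: count_list_take_Suc split: if_splits)
  with \<open>i < length w\<close> that show ?thesis by blast
qed

lemma inversions_le_count: "inversions w c a \<le> count_list w c"
  unfolding inversions_def by (metis count_list_append le_add1 takeWhile_dropWhile_id)

lemma inversions_le:
  assumes "0 < count_list (take i w) a"
  shows "inversions w c a \<le> count_list (take i w) c"
proof -
  define j where "j = length (takeWhile (\<lambda>x. x \<noteq> a) w)"
  have tw: "takeWhile (\<lambda>x. x \<noteq> a) w = take j w"
    unfolding j_def by (rule takeWhile_eq_take)
  have "a \<notin> set (take j w)"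
    unfolding tw[symmetric] by (auto dest: set_takeWhileD)
  then have "j \<le> i"
    using assms count_list_take_mono[of i j w a] by (cases "i \<le> j") auto
  then show ?thesis
    unfolding inversions_def tw by (rule count_list_take_mono)
qed

text \<open>The prefix still lacks an a, so a larger letter c found in it after the first a would
  stand between two copies of a. Hence all its copies of c precede the a-block.\<close>

lemma le_inversions:
  assumes av: "avoids_121 w" and "a < c" and lt: "count_list (take i w) a < count_list w a"
  shows "count_list (take i w) c \<le> inversions w c a"
proof -
  define j where "j = length (takeWhile (\<lambda>x. x \<noteq> a) w)"
  have tw: "takeWhile (\<lambda>x. x \<noteq> a) w = take j w"
    unfolding j_def by (rule takeWhile_eq_take)
  have a: "a \<in> set w" using lt count_list_pos_iff[of w a] by simp
  have j: "j < length w" 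
  proof (rule ccontr)
    assume "\<not> j < length w"
    then have "takeWhile (\<lambda>x. x \<noteq> a) w = w" by (simp add: tw)
    with a show False by (metis (mono_tags, lifting) set_takeWhileD)
  qed
  have wj: "w ! j = a" unfolding j_def using nth_length_takeWhile[OF j[unfolded j_def]] by simp
  have "count_list (take k w) c \<le> count_list (take j w) c" if "k \<le> i" for k
    using that
  proof (induction k)
    case (Suc k)
    then have IH: "count_list (take k w) c \<le> count_list (take j w) c" by simp
    show ?case
    proof (cases "k < length w \<and> w ! k = c")
      case False
      then show ?thesis
        using IH by (cases "k < length w") (auto simp: count_list_take_Suc)
    next
      case True
      show ?thesis
      proof (cases "k < j")
        case True
        then show ?thesis by (simp add: count_list_take_mono)
      next
        case False
        then have "j < k" using True wj \<open>a < c\<close> by (metis less_irrefl linorder_neqE_nat)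
        have "w = take k w @ w ! k # drop (Suc k) w"
          using True by (intro id_take_nth_drop) simp
        moreover have "a \<in> set (take k w)"
          using wj j \<open>j < k\<close> by (auto simp: in_set_conv_nth intro!: exI[of _ j])
        moreover have "a \<in> set (drop (Suc k) w)"
        proof -
          have "count_list (take (Suc k) w) a < count_list w a"
            using count_list_take_mono[OF Suc.prems, of w a] lt by simp
          moreover have "count_list w a = count_list (take (Suc k) w) a + count_list (drop (Suc k) w) a"
            by (metis append_take_drop_id count_list_append)
          ultimately show ?thesis using count_list_pos_iff by fastforce
        qed
        ultimately have "w ! k \<le> a" using av unfolding avoids_121_def by blast
        with True \<open>a < c\<close> show ?thesis by simp
      qed
    qed
  qed simp
  then show ?thesis unfolding inversions_def tw by simp
qed

text \<open>At an occurrence of a both bounds apply: the prefix before it lacks an a, the prefix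
  after it contains one, and the step between them adds no c.\<close>

lemma count_eq_inversions:
  assumes "avoids_121 w" "a < c" "i < length w" "w ! i = a"
  shows "count_list (take i w) c = inversions w c a"
    "count_list (take (Suc i) w) c = inversions w c a"
proof -
  have 1: "count_list (take i w) c \<le> inversions w c a"
    using assms by (intro le_inversions count_list_take_less)
  have "inversions w c a \<le> count_list (take (Suc i) w) c"
    using assms by (intro inversions_le) (simp add: count_list_take_Suc)
  with 1 assms show "count_list (take i w) c = inversions w c a"
    "count_list (take (Suc i) w) c = inversions w c a"
    by (auto simp: count_list_take_Suc)
qed

text \<open>The candidate is the shortest prefix in which every letter of \<open>S\<close> reaches
  its target. Its last letter x attains the target exactly. A larger letter has its inversion number
  over x as count and is bounded by \<open>above\<close>; an excess of a smaller letter contradicts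
  \<open>below\<close>.\<close>

lemma prefix_with_counts:
  assumes av: "avoids_121 w"
    and le: "\<And>c. c \<in> S \<Longrightarrow> p c \<le> count_list w c"
    and below: "\<And>b c. b \<in> S \<Longrightarrow> c \<in> S \<Longrightarrow> b < c \<Longrightarrow> p b < count_list w b \<Longrightarrow> p c \<le> inversions w c b"
    and above: "\<And>b c. b \<in> S \<Longrightarrow> c \<in> S \<Longrightarrow> b < c \<Longrightarrow> 0 < p b \<Longrightarrow> inversions w c b \<le> p c"
  obtains i where "i \<le> length w" "\<And>c. c \<in> S \<Longrightarrow> count_list (take i w) c = p c"
proof -
  define P where "P i \<longleftrightarrow> (\<forall>c\<in>S. p c \<le> count_list (take i w) c)" for i
  define m where "m = (LEAST i. P i)"
  have Pl: "P (length w)" using le by (simp add: P_def)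
  have Pm: "P m" unfolding m_def by (rule LeastI, rule Pl)
  have ml: "m \<le> length w" unfolding m_def by (rule Least_le, rule Pl)
  have "count_list (take m w) c = p c" if c: "c \<in> S" for c
  proof (cases m)
    case 0
    then show ?thesis using Pm c by (auto simp: P_def)
  next
    case (Suc j)
    have jl: "j < length w" using ml Suc by simp
    have "\<not> P j" using not_less_Least[of j P] Suc by (simp add: m_def)
    then obtain x where x: "x \<in> S" "count_list (take j w) x < p x"
      by (auto simp: P_def not_le)
    have "p x \<le> count_list (take (Suc j) w) x" using Pm x(1) Suc by (simp add: P_def)
    with x jl have wj: "w ! j = x" and px: "count_list (take (Suc j) w) x = p x"
      by (auto simp: count_list_take_Suc split: if_splits)
    have ge: "p c \<le> count_list (take m w) c" using Pm c by (simp add: P_def)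
    consider "c = x" | "x < c" | "c < x" by linarith
    then show ?thesis
    proof cases
      case 1
      then show ?thesis using px Suc by simp
    next
      case 2
      then have "count_list (take m w) c = inversions w c x"
        using count_eq_inversions(2)[OF av 2 jl wj] Suc by simp
      also have "\<dots> \<le> p c" using above[OF x(1) c 2] x(2) by simp
      finally show ?thesis using ge by simp
    next
      case 3
      show ?thesis
      proof (rule ccontr)
        assume "count_list (take m w) c \<noteq> p c"
        then have gt: "p c < count_list (take m w) c" using ge by simp
        then have "p c < count_list w c" using count_list_take_le[of m w c] by simp
        then have "p x \<le> inversions w x c" using below[OF c x(1) 3] by simp
        moreover have "0 < count_list (take j w) c"
          using gt 3 wj jl Suc by (simp add: count_list_take_Suc)
        then have "inversions w x c \<le> count_list (take j w) x" by (rule inversions_le)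
        ultimately show False using x(2) by simp
      qed
    qed
  qed
  with ml that show ?thesis by blast
qed

text \<open>At the first difference let a < c be the two letters. In the word continuing with a, the
  common prefix holds all copies of c before the a-block. The other word adds one more c while an a
  is still missing, so its inversion number is larger.\<close>

lemma inversions_inject:
  assumes av: "avoids_121 w" "avoids_121 w'"
    and cnt: "\<And>a. count_list w a = count_list w' a"
    and len: "length w = length w'"
    and inv: "\<And>a c. a \<in> set w \<Longrightarrow> c \<in> set w \<Longrightarrow> a < c \<Longrightarrow> inversions w c a = inversions w' c a"
  shows "w = w'"
proof (rule ccontr)
  assume ne: "w \<noteq> w'"
  have set_eq: "set w = set w'" using cnt by (metis count_list_pos_iff subsetI subset_antisym)
  define i where "i = (LEAST i. i < length w \<and> w ! i \<noteq> w' ! i)"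
  have ex: "\<exists>i. i < length w \<and> w ! i \<noteq> w' ! i"
    using ne len by (metis nth_equalityI)
  then have i: "i < length w" "w ! i \<noteq> w' ! i" unfolding i_def by (metis (mono_tags, lifting) LeastI)+
  have "w ! k = w' ! k" if "k < i" for k
    using not_less_Least[of k "\<lambda>i. i < length w \<and> w ! i \<noteq> w' ! i"] that i(1) by (auto simp: i_def[symmetric])
  then have tk: "take i w = take i w'"
    using i len by (intro nth_equalityI) auto
  have key: False
    if "avoids_121 u" "avoids_121 u'" "i < length u" "i < length u'" "take i u = take i u'"
      "u ! i < u' ! i" "count_list u (u ! i) = count_list u' (u ! i)"
      "inversions u (u' ! i) (u ! i) = inversions u' (u' ! i) (u ! i)" for u u'
  proof -
    have "count_list (take i u') (u ! i) < count_list u' (u ! i)"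
      using count_list_take_less[OF that(3)] that by metis
    then have "count_list (take (Suc i) u') (u ! i) < count_list u' (u ! i)"
      using that by (simp add: count_list_take_Suc)
    then have "count_list (take (Suc i) u') (u' ! i) \<le> inversions u' (u' ! i) (u ! i)"
      using that by (intro le_inversions) auto
    moreover have "count_list (take i u) (u' ! i) = inversions u (u' ! i) (u ! i)"
      using that by (intro count_eq_inversions) auto
    ultimately show False using that by (simp add: count_list_take_Suc)
  qed
  have "w ! i \<in> set w" "w' ! i \<in> set w'" using i len by simp_all
  with set_eq have "w ! i \<in> set w" "w' ! i \<in> set w" by blast+
  then show False
    using key[OF av(1,2), unfolded cnt] key[OF av(2,1), unfolded cnt] i len tk
      inv[of "w ! i" "w' ! i"] inv[of "w' ! i" "w ! i"]
    by (cases "w ! i < w' ! i") auto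
qed

text \<open>A forbidden pattern around a letter other than m survives deletion of the inserted
  copies, so it would occur in the old word. Around m it would need a larger letter between adjacent
  equal letters.\<close>

lemma avoids_121_insert_block:
  assumes av: "avoids_121 (\<alpha> @ \<beta>)" and gt: "\<And>x. x \<in> set (\<alpha> @ \<beta>) \<Longrightarrow> m < x"
  shows "avoids_121 (\<alpha> @ replicate k m @ \<beta>)"
  unfolding avoids_121_def
proof (intro allI impI)
  fix u y v x
  assume eq: "\<alpha> @ replicate k m @ \<beta> = u @ y # v" and xu: "x \<in> set u" and xv: "x \<in> set v"
  have mnot: "m \<notin> set \<alpha>" "m \<notin> set \<beta>" using gt by fastforce+
  show "y \<le> x"
  proof (rule ccontr)
    assume "\<not> y \<le> x"
    then have xy: "x < y" by simp
    have all: "z \<in> set (u @ y # v) \<Longrightarrow> m \<le> z" for z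
      unfolding eq[symmetric] using gt by (auto dest: less_imp_le)
    then have "m \<le> x" using xu by simp
    with xy have "m < y" by simp
    show False
    proof (cases "x = m")
      case False
      then have "m < x" using all[of x] xu by simp
      have "\<alpha> @ \<beta> = filter (\<lambda>z. z \<noteq> m) (\<alpha> @ replicate k m @ \<beta>)"
      proof -
        have "filter (\<lambda>z. z \<noteq> m) \<alpha> = \<alpha>" "filter (\<lambda>z. z \<noteq> m) \<beta> = \<beta>"
          using mnot by (auto intro!: filter_True simp del: filter_True)
        then show ?thesis by simp
      qed
      also have "\<dots> = filter (\<lambda>z. z \<noteq> m) u @ y # filter (\<lambda>z. z \<noteq> m) v"
        unfolding eq using \<open>m < y\<close> by simp
      finally have "\<alpha> @ \<beta> = filter (\<lambda>z. z \<noteq> m) u @ y # filter (\<lambda>z. z \<noteq> m) v" .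
      moreover have "x \<in> set (filter (\<lambda>z. z \<noteq> m) u)" "x \<in> set (filter (\<lambda>z. z \<noteq> m) v)"
        using xu xv False by auto
      ultimately have "y \<le> x" using av unfolding avoids_121_def by blast
      with xy show False by simp
    next
      case True
      have "\<not> (\<exists>us. u @ us = \<alpha>)" using xu True mnot by auto
      then obtain us where us: "u = \<alpha> @ us" "us @ y # v = replicate k m @ \<beta>"
        using iffD1[OF append_eq_append_conv2 eq] by metis
      have "\<not> (\<exists>us'. us' @ y # v = \<beta>)" using xv True mnot by auto
      then obtain us' where us': "us @ us' = replicate k m" "y # v = us' @ \<beta>"
        using iffD1[OF append_eq_append_conv2 us(2)] by metis
      show False
      proof (cases us')
        case Nil
        then show False using us' xv True mnot by (metis append_Nil set_ConsD set_subset_Cons subsetD)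
      next
        case (Cons z zs)
        then have "y \<in> set (replicate k m)" using us' by (metis append_Cons in_set_conv_decomp list.inject)
        then show False using \<open>m < y\<close> by auto
      qed
    qed
  qed
qed

lemma takeWhile_filter_neq:
  "a \<noteq> m \<Longrightarrow> filter (\<lambda>z. z \<noteq> m) (takeWhile (\<lambda>z. z \<noteq> a) w) =
    takeWhile (\<lambda>z. z \<noteq> a) (filter (\<lambda>z. z \<noteq> m) w)"
  by (induction w) auto

lemma count_list_filter_neq: "c \<noteq> m \<Longrightarrow> count_list (filter (\<lambda>z. z \<noteq> m) w) c = count_list w c"
  by (induction w) auto

lemma inversions_filter_neq:
  "a \<noteq> m \<Longrightarrow> c \<noteq> m \<Longrightarrow> inversions (filter (\<lambda>z. z \<noteq> m) w) c a = inversions w c a"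
  unfolding inversions_def by (metis count_list_filter_neq takeWhile_filter_neq)

text \<open>The word is built by inserting the blocks of \<open>n, n - 1, \<dots>\<close> in turn: the prescribed numbers
  \<open>I c m\<close> with \<open>c > m\<close> are the letter counts of the prefix after which the block of \<open>m\<close> goes.\<close>

lemma exists_word_with_inversions:
  fixes p :: "nat \<Rightarrow> nat" and I :: "nat \<Rightarrow> nat \<Rightarrow> nat"
  assumes pos: "\<And>i. 1 \<le> i \<Longrightarrow> i \<le> n \<Longrightarrow> 0 < p i"
    and le: "\<And>a c. 1 \<le> a \<Longrightarrow> a < c \<Longrightarrow> c \<le> n \<Longrightarrow> I c a \<le> p c"
    and trans: "\<And>a b c. 1 \<le> a \<Longrightarrow> a < b \<Longrightarrow> b < c \<Longrightarrow> c \<le> n \<Longrightarrow> 0 < I b a \<Longrightarrow> I c b \<le> I c a"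
    and planar: "\<And>a b c. 1 \<le> a \<Longrightarrow> a < b \<Longrightarrow> b < c \<Longrightarrow> c \<le> n \<Longrightarrow> I b a < p b \<Longrightarrow> I c a \<le> I c b"
  obtains w where "set w \<subseteq> {1..n}" "\<And>i. i \<in> {1..n} \<Longrightarrow> count_list w i = p i" "avoids_121 w"
    "\<And>a c. 1 \<le> a \<Longrightarrow> a < c \<Longrightarrow> c \<le> n \<Longrightarrow> inversions w c a = I c a"
proof -
  have "\<exists>w. set w \<subseteq> {n + 1 - k..n} \<and> (\<forall>i\<in>{n + 1 - k..n}. count_list w i = p i) \<and> avoids_121 w \<and>
      (\<forall>a c. n + 1 - k \<le> a \<longrightarrow> a < c \<longrightarrow> c \<le> n \<longrightarrow> inversions w c a = I c a)"
    if "k \<le> n" for k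
    using that
  proof (induction k)
    case 0
    then show ?case by (intro exI[of _ "[]"]) (auto simp: avoids_121_def)
  next
    case (Suc k)
    define m where "m = n - k"
    have m: "1 \<le> m" "m \<le> n" "n + 1 - k = Suc m" "n + 1 - Suc k = m"
      using Suc.prems by (auto simp: m_def)
    obtain w where w: "set w \<subseteq> {Suc m..n}" "\<forall>i\<in>{Suc m..n}. count_list w i = p i" "avoids_121 w"
      "\<forall>a c. Suc m \<le> a \<longrightarrow> a < c \<longrightarrow> c \<le> n \<longrightarrow> inversions w c a = I c a"
      using Suc m by auto
    obtain i where i: "i \<le> length w" "\<And>c. c \<in> {Suc m..n} \<Longrightarrow> count_list (take i w) c = I c m"
    \<comment> \<open>Planarity is the hypothesis for letters b not yet exhausted, transitivity the
      one for letters b already begun.\<close>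
    proof (rule prefix_with_counts[OF w(3), of "{Suc m..n}" "\<lambda>c. I c m"])
      show "I c m \<le> count_list w c" if "c \<in> {Suc m..n}" for c
        using le[of m c] m w(2) that by auto
      show "I c m \<le> inversions w c b"
        if "b \<in> {Suc m..n}" "c \<in> {Suc m..n}" "b < c" "I b m < count_list w b" for b c
        using planar[of m b c] m w that by auto
      show "inversions w c b \<le> I c m"
        if "b \<in> {Suc m..n}" "c \<in> {Suc m..n}" "b < c" "0 < I b m" for b c
        using trans[of m b c] m w that by auto
    qed blast
    define w' where "w' = take i w @ replicate (p m) m @ drop i w"
    have sets: "set (take i w) \<subseteq> {Suc m..n}" "set (drop i w) \<subseteq> {Suc m..n}"
      using w(1) set_take_subset set_drop_subset by fastforce+
    then have notin: "m \<notin> set (take i w)" "m \<notin> set (drop i w)" by auto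
    have cnt: "count_list w' j = (if j = m then p m else count_list w j)" for j
    proof -
      have "count_list w j = count_list (take i w) j + count_list (drop i w) j"
        by (metis append_take_drop_id count_list_append)
      moreover have "count_list (replicate (p m) m) j = (if j = m then p m else 0)"
        by (auto simp: count_list_eq_length_filter)
      ultimately show ?thesis using notin by (auto simp: w'_def)
    qed
    have fil: "filter (\<lambda>z. z \<noteq> m) w' = w"
    proof -
      have "filter (\<lambda>z. z \<noteq> m) (take i w) = take i w" "filter (\<lambda>z. z \<noteq> m) (drop i w) = drop i w"
        using notin by (auto intro!: filter_True simp del: filter_True)
      then show ?thesis unfolding w'_def by simp
    qed
    have "set w' \<subseteq> {m..n}" using sets m by (auto simp: w'_def)
    moreover have "\<forall>j\<in>{m..n}. count_list w' j = p j"
      using w(2) cnt by auto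
    moreover have "avoids_121 w'"
      unfolding w'_def using w(1,3) by (intro avoids_121_insert_block) auto
    moreover have "inversions w' c a = I c a" if "m \<le> a" "a < c" "c \<le> n" for a c
    proof (cases "a = m")
      case False
      then show ?thesis using inversions_filter_neq[of a m c w'] that w(4) fil by simp
    next
      case True
      have "takeWhile (\<lambda>x. x \<noteq> m) w' = take i w"
      proof -
        obtain q where "p m = Suc q" using pos[of m] m by (cases "p m") auto
        then have "w' = take i w @ m # replicate q m @ drop i w" by (simp add: w'_def)
        moreover have "takeWhile (\<lambda>x. x \<noteq> m) (take i w @ m # v) = take i w" for v
          using notin by (subst takeWhile_append2) auto
        ultimately show ?thesis by simp
      qed
      then show ?thesis unfolding inversions_def using True that i(2) by simp
    qed
    ultimately show ?case unfolding m by blast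
  qed
  from this[of n] show ?thesis using that by (auto simp: Suc_le_eq)
qed

subsection \<open>Routes and coherence\<close>

text \<open>Indices decrease from the source-edge at k down to 1, since a route meets the vertices
  v_{n+1-k}, ..., v_n in this order.\<close>

definition route_with :: "nat \<Rightarrow> (nat \<Rightarrow> nat) \<Rightarrow> (nat \<times> nat) list" where
  "route_with k f = map (\<lambda>a. (a, f a)) (rev [1..<Suc k])"

lemma mem_route_with: "(a, x) \<in> set (route_with k f) \<longleftrightarrow> 1 \<le> a \<and> a \<le> k \<and> x = f a"
  by (auto simp: route_with_def)

lemma route_with_Suc: "route_with (Suc k) f = (Suc k, f (Suc k)) # route_with k f"
  by (simp add: route_with_def)

lemma route_with_cong: "(\<And>a. 1 \<le> a \<Longrightarrow> a \<le> k \<Longrightarrow> f a = g a) \<Longrightarrow> route_with k f = route_with k g"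
  by (auto simp: route_with_def)

lemma distinct_route_with: "distinct (route_with k f)"
  by (auto simp: route_with_def distinct_map inj_on_def)

text \<open>Only indices present on both routes are compared. The relation is not transitive: a
  route starting at a small index says nothing about larger ones.\<close>

definition route_le :: "(nat \<times> nat) list \<Rightarrow> (nat \<times> nat) list \<Rightarrow> bool" where
  "route_le P Q \<longleftrightarrow> (\<forall>a x y. (a, x) \<in> set P \<longrightarrow> (a, y) \<in> set Q \<longrightarrow> x \<le> y)"

locale oruga_graph =
  fixes s :: "nat list"
  assumes comp: "composition s"
begin

abbreviation n :: nat where "n \<equiv> length s"

definition route_shape :: "nat \<Rightarrow> (nat \<Rightarrow> nat) \<Rightarrow> bool" where
  "route_shape k f \<longleftrightarrow> 1 \<le> k \<and> k \<le> Suc n \<and> 0 < f k \<and> f k < part s k \<and>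
     (\<forall>a. 1 \<le> a \<and> a < k \<longrightarrow> f a = 0 \<or> f a = part s a)"

section \<open>Routes as paths with one label per index\<close>

lemma part_pos: "1 \<le> i \<Longrightarrow> i \<le> Suc n \<Longrightarrow> 0 < part s i"
  using comp by (auto simp: part_def composition_def nth_append)

lemma part_last: "part s (Suc n) = 2"
  by (simp add: part_def)

lemma arcs_oruga_iff:
  "(i, t) \<in> arcs (oruga s) \<longleftrightarrow> 1 \<le> i \<and> i \<le> Suc n \<and> t \<le> part s i \<and> (i = Suc n \<longrightarrow> t = 1)"
proof (cases "i = Suc n")
  case True
  then show ?thesis by (auto simp: oruga_def part_last)
next
  case False
  then show ?thesis using part_pos[of i] by (auto simp: oruga_def)
qed

lemma finite_arcs_oruga: "finite (arcs (oruga s))"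
proof (rule finite_subset)
  show "arcs (oruga s) \<subseteq> (SIGMA i:{1..Suc n}. {..part s i})"
    by (auto simp: arcs_oruga_iff)
qed simp

lemma verts_oruga: "verts (oruga s) = {-1..int n}"
  by (simp add: oruga_def)

lemma tail_oruga: "tail (oruga s) (i, t) = (if 0 < t \<and> t < part s i then -1 else int n - int i)"
  by (simp add: oruga_def)

lemma head_oruga: "head (oruga s) (i, t) = int n + 1 - int i"
  by (simp add: oruga_def)

text \<open>From v_{n-j} only the bump and the dip of index j leave, because source-edges start at
  v_{-1}. The walk is forced up to one binary choice per index.\<close>

lemma walk_to_sink:
  assumes "j \<le> n" "pre_digraph.cas (oruga s) (int n - int j) p (int n)" "set p \<subseteq> arcs (oruga s)"
  shows "\<exists>f. p = route_with j f \<and> (\<forall>a. 1 \<le> a \<and> a \<le> j \<longrightarrow> f a = 0 \<or> f a = part s a)"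
  using assms
proof (induction j arbitrary: p)
  case 0
  have "p = []"
  proof (cases p)
    case (Cons e es)
    obtain i t where e: "e = (i, t)" by fastforce
    then have "tail (oruga s) (i, t) = int n" "(i, t) \<in> arcs (oruga s)"
      using 0 Cons by (auto simp: pre_digraph.cas.simps)
    then show ?thesis by (auto simp: tail_oruga arcs_oruga_iff split: if_splits)
  qed
  then show ?case by (auto simp: route_with_def)
next
  case (Suc j)
  obtain e es where p: "p = e # es"
    using Suc.prems by (cases p) (auto simp: pre_digraph.cas.simps)
  obtain i t where e: "e = (i, t)" by fastforce
  have t: "tail (oruga s) (i, t) = int n - int (Suc j)" and c: "pre_digraph.cas (oruga s) (head (oruga s) (i, t)) es (int n)"
    and a: "(i, t) \<in> arcs (oruga s)"
    using Suc.prems p e by (auto simp: pre_digraph.cas.simps)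
  have i: "i = Suc j"
    using t a Suc.prems(1) by (auto simp: tail_oruga arcs_oruga_iff split: if_splits)
  have tt: "t = 0 \<or> t = part s (Suc j)"
    using t a Suc.prems(1) unfolding i by (auto simp: tail_oruga arcs_oruga_iff split: if_splits)
  have "pre_digraph.cas (oruga s) (int n - int j) es (int n)"
    using c by (simp add: i head_oruga)
  then obtain f where f: "es = route_with j f" "\<forall>a. 1 \<le> a \<and> a \<le> j \<longrightarrow> f a = 0 \<or> f a = part s a"
    using Suc.IH[of es] Suc.prems p by auto
  let ?f = "f(Suc j := t)"
  have "p = route_with (Suc j) ?f"
    unfolding route_with_Suc p e i f(1) by (auto intro: route_with_cong)
  moreover have "\<forall>a. 1 \<le> a \<and> a \<le> Suc j \<longrightarrow> ?f a = 0 \<or> ?f a = part s a"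
    using f(2) tt by (auto simp: le_Suc_eq)
  ultimately show ?case by blast
qed

lemma cas_segment:
  assumes "i \<le> j" "\<And>a. i \<le> a \<Longrightarrow> a < j \<Longrightarrow> f a = 0 \<or> f a = part s a"
  shows "pre_digraph.cas (oruga s) (int n + 1 - int j) (map (\<lambda>a. (a, f a)) (rev [i..<j])) (int n + 1 - int i)"
  using assms
proof (induction j)
  case (Suc j)
  show ?case
  proof (cases "i \<le> j")
    case True
    then have "f j = 0 \<or> f j = part s j" using Suc.prems(2) by simp
    then have "tail (oruga s) (j, f j) = int n + 1 - int (Suc j)" by (auto simp: tail_oruga)
    then show ?thesis
      using Suc.IH Suc.prems(2) True by (simp add: pre_digraph.cas.simps head_oruga)
  next
    case False
    then show ?thesis using Suc.prems by (auto simp: pre_digraph.cas.simps)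
  qed
qed (simp add: pre_digraph.cas.simps)

lemma cas_initial_segment:
  assumes "route_shape k f" "1 \<le> i" "i \<le> k"
  shows "pre_digraph.cas (oruga s) (-1) (map (\<lambda>a. (a, f a)) (rev [i..<Suc k])) (int n + 1 - int i)"
  using assms cas_segment[of i k f]
  by (auto simp: route_shape_def pre_digraph.cas.simps tail_oruga head_oruga)

lemma route_with_in_routes:
  assumes "route_shape k f"
  shows "route_with k f \<in> routes s"
proof -
  let ?R = "route_with k f"
  have k: "1 \<le> k" "k \<le> Suc n" using assms by (auto simp: route_shape_def)
  have cas: "pre_digraph.cas (oruga s) (-1) ?R (int n)"
    using cas_initial_segment[OF assms, of 1] k by (simp add: route_with_def)
  have arcs: "set ?R \<subseteq> arcs (oruga s)"
  proof clarify
    fix a x assume "(a, x) \<in> set ?R"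
    then have ax: "1 \<le> a" "a \<le> k" "x = f a" by (auto simp: mem_route_with)
    have "x = 1" if "a = Suc n"
      using assms ax that part_last unfolding route_shape_def by auto
    moreover have "x \<le> part s a"
      using assms ax unfolding route_shape_def by (cases "a = k") auto
    ultimately show "(a, x) \<in> arcs (oruga s)"
      using ax k by (auto simp: arcs_oruga_iff)
  qed
  have ne: "?R \<noteq> []" using k by (simp add: route_with_def)
  have "map (head (oruga s)) ?R = map (\<lambda>a. int n + 1 - int a) (rev [1..<Suc k])"
    by (simp add: route_with_def head_oruga)
  moreover have "tail (oruga s) (hd ?R) = -1"
    using cas ne by (cases ?R) (auto simp: pre_digraph.cas.simps)
  ultimately have "pre_digraph.awalk_verts (oruga s) (-1) ?R =
      -1 # map (\<lambda>a. int n + 1 - int a) (rev [1..<Suc k])"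
    using pre_digraph.awalk_verts_conv'[OF cas] ne by simp
  moreover have "distinct \<dots>"
    using k by (auto simp: distinct_map inj_on_def simp del: upt_Suc)
  ultimately show ?thesis
    unfolding routes_def pre_digraph.apath_def pre_digraph.awalk_def
    using cas arcs by (simp add: verts_oruga)
qed

lemma routesE:
  assumes "R \<in> routes s"
  obtains k f where "route_shape k f" "R = route_with k f"
proof -
  have cas: "pre_digraph.cas (oruga s) (-1) R (int n)" and arcs: "set R \<subseteq> arcs (oruga s)"
    using assms unfolding routes_def pre_digraph.apath_def pre_digraph.awalk_def by auto
  obtain e es where R: "R = e # es" using cas by (cases R) (auto simp: pre_digraph.cas.simps)
  obtain k t where e: "e = (k, t)" by fastforce
  have t: "tail (oruga s) (k, t) = -1" and c: "pre_digraph.cas (oruga s) (head (oruga s) (k, t)) es (int n)"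
    and a: "(k, t) \<in> arcs (oruga s)"
    using cas arcs R e by (auto simp: pre_digraph.cas.simps)
  from a have k: "1 \<le> k" "k \<le> Suc n" by (auto simp: arcs_oruga_iff)
  \<comment> \<open>Bumps and dips of index at most n start at n - k \<ge> 0, so an edge leaving
    v_{-1} is a source-edge; at index n + 1 only the label 1 exists.\<close>
  have tk: "0 < t \<and> t < part s k"
  proof (cases "k = Suc n")
    case True
    then show ?thesis using a part_last by (simp add: arcs_oruga_iff)
  next
    case False
    then show ?thesis using t k by (auto simp: tail_oruga split: if_splits)
  qed
  have "pre_digraph.cas (oruga s) (int n - int (k - 1)) es (int n)"
    using c k by (simp add: head_oruga of_nat_diff algebra_simps)
  moreover have "k - 1 \<le> n" "set es \<subseteq> arcs (oruga s)" using k arcs R by auto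
  ultimately obtain f where f: "es = route_with (k - 1) f"
      "\<forall>a. 1 \<le> a \<and> a \<le> k - 1 \<longrightarrow> f a = 0 \<or> f a = part s a"
    using walk_to_sink by blast
  let ?f = "f(k := t)"
  have "route_with (k - 1) f = route_with (k - 1) ?f"
    using k by (intro route_with_cong) auto
  then have "R = route_with k ?f"
    using k route_with_Suc[of "k - 1" ?f] f(1) R e by simp
  moreover have "route_shape k ?f"
    using k tk f(2) unfolding route_shape_def by auto
  ultimately show ?thesis using that by blast
qed

lemma routes_subset_arcs: "R \<in> routes s \<Longrightarrow> set R \<subseteq> arcs (oruga s)"
  by (simp add: routes_def pre_digraph.apath_def pre_digraph.awalk_def)

lemma routes_cas: "R \<in> routes s \<Longrightarrow> pre_digraph.cas (oruga s) (-1) R (int n)"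
  by (simp add: routes_def pre_digraph.apath_def pre_digraph.awalk_def)

lemma routes_range: "R \<in> routes s \<Longrightarrow> (a, x) \<in> set R \<Longrightarrow> 1 \<le> a \<and> a \<le> Suc n \<and> x \<le> part s a"
  using routes_subset_arcs[of R] arcs_oruga_iff[of a x] by auto

lemma routes_below:
  assumes "R \<in> routes s" "(c, x) \<in> set R" "1 \<le> a" "a < c"
  shows "(a, 0) \<in> set R \<or> (a, part s a) \<in> set R"
  using assms by (elim routesE) (force simp: mem_route_with route_shape_def)

text \<open>A route has one source-edge, at its top index. The label of Q there is neither 0 nor
  full, so R has its source-edge at the same index. This antichain property separates the vertices
  of route simplices.\<close>

lemma routes_set_mono:
  assumes "Q \<in> routes s" "R \<in> routes s" "set Q \<subseteq> set R"
  shows "Q = R"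
proof -
  obtain k f l g where Q: "route_shape k f" "Q = route_with k f" and R: "route_shape l g" "R = route_with l g"
    using assms by (metis routesE)
  have eq: "a \<le> l \<and> f a = g a" if "1 \<le> a" "a \<le> k" for a
  proof -
    have "(a, f a) \<in> set R" using assms(3) Q(2) that by (auto simp: mem_route_with)
    then show ?thesis using R(2) by (auto simp: mem_route_with)
  qed
  have k: "1 \<le> k" "0 < f k" "f k < part s k" using Q by (auto simp: route_shape_def)
  have "k \<le> l" "f k = g k" using eq[of k] k by auto
  moreover have "\<not> k < l" using R(1) k \<open>f k = g k\<close> by (auto simp: route_shape_def)
  ultimately have "k = l" by simp
  then show ?thesis using Q R eq by (auto intro: route_with_cong)
qed

lemma finite_routes: "finite (routes s)"
proof (rule inj_on_finite)
  show "inj_on set (routes s)" using routes_set_mono by (auto intro!: inj_onI)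
  show "set ` routes s \<subseteq> Pow (arcs (oruga s))" using routes_subset_arcs by auto
qed (simp add: finite_arcs_oruga)

section \<open>Coherence as componentwise comparability\<close>

lemma initial_prec_iff:
  assumes "p \<noteq> []" "q \<noteq> []" "last p \<noteq> last q"
  shows "initial_prec s p q \<longleftrightarrow> in_prec s (last p) (last q)"
proof
  assume "initial_prec s p q"
  then obtain x y e f r where h: "p = x @ [e] @ r" "q = y @ [f] @ r" "in_prec s e f"
    unfolding initial_prec_def by blast
  then have "r = []" using assms(3) by (cases r rule: rev_cases) auto
  then show "in_prec s (last p) (last q)" using h by simp
next
  assume "in_prec s (last p) (last q)"
  then show "initial_prec s p q"
    unfolding initial_prec_def using assms
    by (intro exI[of _ "butlast p"] exI[of _ "butlast q"] exI[of _ "last p"] exI[of _ "last q"]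
        exI[of _ "[]"]) simp
qed

lemma final_prec_iff:
  assumes "p \<noteq> []" "q \<noteq> []" "hd p \<noteq> hd q"
  shows "final_prec s p q \<longleftrightarrow> out_prec s (hd p) (hd q)"
proof
  assume "final_prec s p q"
  then obtain x y e f r where h: "p = r @ [e] @ x" "q = r @ [f] @ y" "out_prec s e f"
    unfolding final_prec_def by blast
  then have "r = []" using assms(3) by (cases r) auto
  then show "out_prec s (hd p) (hd q)" using h by simp
next
  assume "out_prec s (hd p) (hd q)"
  then show "final_prec s p q"
    unfolding final_prec_def using assms
    by (intro exI[of _ "tl p"] exI[of _ "tl q"] exI[of _ "hd p"] exI[of _ "hd q"]
        exI[of _ "[]"]) simp
qed

lemma cas_append:
  "pre_digraph.cas G u (p @ q) v \<longleftrightarrow>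
    (\<exists>w. pre_digraph.cas G u p w \<and> pre_digraph.cas G w q v)"
  by (induction p arbitrary: u) (auto simp: pre_digraph.cas.simps)

lemma cas_unique: "pre_digraph.cas G u p v \<Longrightarrow> pre_digraph.cas G u p v' \<Longrightarrow> v = v'"
  by (induction p arbitrary: u) (auto simp: pre_digraph.cas.simps)

lemma cas_last:
  "pre_digraph.cas G u p v \<Longrightarrow> p \<noteq> [] \<Longrightarrow> head G (last p) = v"
  by (induction p arbitrary: u) (auto simp: pre_digraph.cas.simps split: if_splits)

text \<open>At a maximal common subpath each comparison is decided at one index: c for the entering
  edges, b for the leaving ones. Comparability gives both the same sign.\<close>

lemma coherent_if_route_le:
  assumes P: "P \<in> routes s" and Q: "Q \<in> routes s" and le: "route_le P Q \<or> route_le Q P"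
  shows "coherent s P Q"
  unfolding coherent_def
proof (intro ballI allI impI; elim conjE)
  fix u v p q m p' q'
  assume uv: "u \<in> inner s" "v \<in> inner s" and Peq: "P = p @ m @ p'" and Qeq: "Q = q @ m @ q'"
    and wp: "pre_digraph.awalk (oruga s) (-1) p u" and wq: "pre_digraph.awalk (oruga s) (-1) q u"
    and wm: "pre_digraph.awalk (oruga s) u m v"
    and ne: "last p \<noteq> last q" "hd p' \<noteq> hd q'"
  have cp: "pre_digraph.cas (oruga s) (-1) p u" and cq: "pre_digraph.cas (oruga s) (-1) q u"
    and cm: "pre_digraph.cas (oruga s) u m v"
    using wp wq wm by (auto simp: pre_digraph.awalk_def)
  have u0: "0 \<le> u" "u < int n" and v0: "0 \<le> v" "v < int n" using uv by (auto simp: inner_def)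
  have pq: "p \<noteq> []" "q \<noteq> []" using cp cq u0 by (auto simp: pre_digraph.cas.simps)
  have cp': "pre_digraph.cas (oruga s) v p' (int n)"
    using routes_cas[OF P] cas_unique[OF cp] cas_unique[OF cm] unfolding Peq cas_append by blast
  have cq': "pre_digraph.cas (oruga s) v q' (int n)"
    using routes_cas[OF Q] cas_unique[OF cq] cas_unique[OF cm] unfolding Qeq cas_append by blast
  have pq': "p' \<noteq> []" "q' \<noteq> []" using cp' cq' v0 by (auto simp: pre_digraph.cas.simps)
  obtain c x c' y where l: "last p = (c, x)" "last q = (c', y)" by fastforce
  have hl: "head (oruga s) (c, x) = u" "head (oruga s) (c', y) = u"
    using cas_last[OF cp] cas_last[OF cq] pq l by auto
  then have "c' = c" by (simp add: head_oruga)
  obtain b x' b' y' where h: "hd p' = (b, x')" "hd q' = (b', y')" by fastforce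
  have tl: "tail (oruga s) (b, x') = v" "tail (oruga s) (b', y') = v"
    using cp' cq' pq' h by (cases p'; cases q'; auto simp: pre_digraph.cas.simps)+
  then have "b' = b" using v0 by (auto simp: tail_oruga split: if_splits)
  have mem: "(c, x) \<in> set P" "(c, y) \<in> set Q" "(b, x') \<in> set P" "(b, y') \<in> set Q"
    using l h pq pq' Peq Qeq \<open>c' = c\<close> \<open>b' = b\<close>
    by (metis Un_iff last_in_set set_append hd_in_set)+
  have "x \<noteq> y" "x' \<noteq> y'" using ne l h \<open>c' = c\<close> \<open>b' = b\<close> by auto
  then have "x < y \<longleftrightarrow> x' < y'"
    using le mem unfolding route_le_def by (metis le_less not_le)
  moreover have "initial_prec s p q \<longleftrightarrow> x < y"
    unfolding initial_prec_iff[OF pq ne(1)] l \<open>c' = c\<close> by (simp add: in_prec_def head_oruga)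
  moreover have "final_prec s p' q' \<longleftrightarrow> x' < y'"
    unfolding final_prec_iff[OF pq' ne(2)] h \<open>b' = b\<close>
    using tl v0 \<open>b' = b\<close> by (simp add: out_prec_def)
  ultimately show "initial_prec s p q \<longleftrightarrow> final_prec s p' q'" by simp
qed

lemma coherent_consecutive:
  assumes P: "route_shape k f" and Q: "route_shape l g"
    and coh: "coherent s (route_with k f) (route_with l g)"
    and bc: "1 \<le> b" "b < c" "c \<le> k" "c \<le> l"
    and diff: "f b \<noteq> g b" "f c \<noteq> g c"
    and eq: "\<And>a. b < a \<Longrightarrow> a < c \<Longrightarrow> f a = g a"
  shows "f c < g c \<longleftrightarrow> f b < g b"
proof -
  define seg where "seg h i j = map (\<lambda>a. (a, h a)) (rev [i..<j])" for h :: "nat \<Rightarrow> nat" and i j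
  have kl: "k \<le> Suc n" "l \<le> Suc n" using P Q by (auto simp: route_shape_def)
  have split: "route_with k' h = seg h c (Suc k') @ seg h (Suc b) c @ seg h 1 (Suc b)" if "c \<le> k'" for k' h
  proof -
    have "[1..<Suc k'] = [1..<Suc b] @ [Suc b..<c] @ [c..<Suc k']"
      using upt_add_eq_append[of 1 "Suc b" "Suc k' - Suc b"] upt_add_eq_append[of "Suc b" c "Suc k' - c"]
        bc that by (simp del: upt_Suc)
    then show ?thesis by (simp add: route_with_def seg_def del: upt_Suc)
  qed
  have m: "seg f (Suc b) c = seg g (Suc b) c" using eq by (auto simp: seg_def)
  have sub: "set (seg f c (Suc k)) \<subseteq> arcs (oruga s)" "set (seg g c (Suc l)) \<subseteq> arcs (oruga s)"
    "set (seg f (Suc b) c) \<subseteq> arcs (oruga s)"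
    using routes_subset_arcs[OF route_with_in_routes[OF P]] routes_subset_arcs[OF route_with_in_routes[OF Q]]
      split[OF bc(3)] split[OF bc(4)] by auto
  let ?u = "int n + 1 - int c" and ?v = "int n + 1 - int (Suc b)"
  have inn: "?u \<in> inner s" "?v \<in> inner s" using bc kl by (auto simp: inner_def)
  have "pre_digraph.awalk (oruga s) (-1) (seg f c (Suc k)) ?u"
    using cas_initial_segment[OF P _ bc(3)] bc sub by (simp add: pre_digraph.awalk_def verts_oruga seg_def)
  moreover have "pre_digraph.awalk (oruga s) (-1) (seg g c (Suc l)) ?u"
    using cas_initial_segment[OF Q _ bc(4)] bc sub by (simp add: pre_digraph.awalk_def verts_oruga seg_def)
  moreover have "pre_digraph.awalk (oruga s) ?u (seg f (Suc b) c) ?v"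
  proof -
    have "pre_digraph.cas (oruga s) ?u (seg f (Suc b) c) ?v"
      unfolding seg_def using P bc by (intro cas_segment) (auto simp: route_shape_def)
    then show ?thesis using sub inn by (auto simp: pre_digraph.awalk_def verts_oruga inner_def)
  qed
  moreover have last: "last (seg h c (Suc k')) = (c, h c)" "seg h c (Suc k') \<noteq> []" if "c \<le> k'" for h k'
    using that by (simp_all add: seg_def last_map last_rev upt_rec[of c])
  moreover have hd: "hd (seg h 1 (Suc b)) = (b, h b)" "seg h 1 (Suc b) \<noteq> []" for h
    using bc by (simp_all add: seg_def)
  ultimately have "initial_prec s (seg f c (Suc k)) (seg g c (Suc l)) \<longleftrightarrow>
      final_prec s (seg f 1 (Suc b)) (seg g 1 (Suc b))"
    using coh inn diff bc split[OF bc(3), of f] split[OF bc(4), of g] m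
    unfolding coherent_def by (metis prod.inject)
  moreover have "initial_prec s (seg f c (Suc k)) (seg g c (Suc l)) \<longleftrightarrow> f c < g c"
    using initial_prec_iff[OF last(2) last(2)] last(1) bc diff
    by (auto simp: in_prec_def head_oruga)
  moreover have "tail (oruga s) (b, h b) = int n - int b" if "h b = 0 \<or> h b = part s b" for h :: "nat \<Rightarrow> nat"
    using that by (auto simp: tail_oruga)
  then have "final_prec s (seg f 1 (Suc b)) (seg g 1 (Suc b)) \<longleftrightarrow> f b < g b"
    using final_prec_iff[OF hd(2) hd(2)] hd(1) P Q bc diff kl
    by (auto simp: out_prec_def route_shape_def)
  ultimately show ?thesis by simp
qed

text \<open>The sign of the difference of labels is the same at neighbouring disagreement indices;
  induction on c - b extends this to any two of them.\<close>

lemma route_le_if_coherent: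
  assumes "P \<in> routes s" "Q \<in> routes s" and coh: "coherent s P Q"
  shows "route_le P Q \<or> route_le Q P"
proof -
  obtain k f l g where P: "route_shape k f" "P = route_with k f" and Q: "route_shape l g" "Q = route_with l g"
    using assms by (metis routesE)
  have key: "f c < g c \<longleftrightarrow> f b < g b"
    if "1 \<le> b" "b < c" "c \<le> k" "c \<le> l" "f b \<noteq> g b" "f c \<noteq> g c" for b c
    using that
  proof (induction "c - b" arbitrary: b c rule: less_induct)
    case less
    show ?case
    proof (cases "\<exists>d. b < d \<and> d < c \<and> f d \<noteq> g d")
      case True
      then obtain d where d: "b < d" "d < c" "f d \<noteq> g d" by blast
      then have "f c < g c \<longleftrightarrow> f d < g d" "f d < g d \<longleftrightarrow> f b < g b"
        using less.hyps[of c d] less.hyps[of d b] less.prems by auto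
      then show ?thesis by simp
    next
      case False
      then show ?thesis
        using coherent_consecutive[OF P(1) Q(1)] coh less.prems P Q by blast
    qed
  qed
  have key': "f c < g c \<longleftrightarrow> f b < g b"
    if "1 \<le> b" "1 \<le> c" "b \<le> k" "b \<le> l" "c \<le> k" "c \<le> l" "f b \<noteq> g b" "f c \<noteq> g c" for b c
    using key[of b c] key[of c b] that by (metis linorder_neqE_nat)
  show ?thesis
  proof (rule ccontr)
    assume "\<not> ?thesis"
    then obtain b c where "1 \<le> b" "1 \<le> c" "b \<le> k" "b \<le> l" "c \<le> k" "c \<le> l" "f b < g b" "g c < f c"
      unfolding route_le_def P(2) Q(2) by (auto simp: mem_route_with not_le)
    then show False using key'[of b c] by auto
  qed
qed

lemma clique_iff:
  "clique s C \<longleftrightarrow> C \<subseteq> routes s \<and> (\<forall>P\<in>C. \<forall>Q\<in>C. route_le P Q \<or> route_le Q P)"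
  unfolding clique_def using coherent_if_route_le route_le_if_coherent by blast

end

subsection \<open>Simplices of routes in the flow polytope\<close>

lemma lookup_scaleR: "Poly_Mapping.lookup (r *\<^sub>R f) e = r *\<^sub>R Poly_Mapping.lookup f e"
proof -
  have "finite {i. r *\<^sub>R Poly_Mapping.lookup f i \<noteq> 0}"
    by (rule finite_subset[OF _ finite_lookup[of f]]) auto
  then show ?thesis
    unfolding scaleR_poly_mapping_def by (simp add: Abs_poly_mapping_inverse)
qed

text \<open>The norm is the sum of the absolute values of all coordinates. Continuity of a
  coordinate makes its strict positivity an open condition.\<close>

lemma bounded_linear_lookup: "bounded_linear (\<lambda>f :: 'a \<Rightarrow>\<^sub>0 real. Poly_Mapping.lookup f e)"
proof (rule bounded_linear_intro[where K = 1])
  fix f :: "'a \<Rightarrow>\<^sub>0 real"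
  show "norm (Poly_Mapping.lookup f e) \<le> norm f * 1"
  proof (cases "e \<in> Poly_Mapping.keys f")
    case True
    then have "\<bar>Poly_Mapping.lookup f e\<bar> \<le> (\<Sum>i\<in>Poly_Mapping.keys f. \<bar>Poly_Mapping.lookup f i\<bar>)"
      by (intro member_le_sum[of e _ "\<lambda>i. \<bar>Poly_Mapping.lookup f i\<bar>"]) auto
    then show ?thesis by (simp add: norm_poly_mapping_def dist_poly_mapping_def)
  next
    case False
    then show ?thesis by (simp add: in_keys_iff)
  qed
qed (simp_all add: lookup_add lookup_scaleR)

lemma lookup_route_indicator:
  "Poly_Mapping.lookup (route_indicator R) e = of_bool (e \<in> set R)"
  by (simp add: route_indicator_def lookup_sum lookup_single when_def)

context oruga_graph
begin

definition net_flow :: "((nat \<times> nat) \<Rightarrow>\<^sub>0 real) \<Rightarrow> int \<Rightarrow> real" where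
  "net_flow f v = (\<Sum>e\<in>out_arcs (oruga s) v. Poly_Mapping.lookup f e) -
     (\<Sum>e\<in>in_arcs (oruga s) v. Poly_Mapping.lookup f e)"

text \<open>The affine space of the conservation equations, without sign conditions. It contains the
  affine hull of the polytope, so near a positive flow only signs have to be checked.\<close>

definition flow_space :: "((nat \<times> nat) \<Rightarrow>\<^sub>0 real) set" where
  "flow_space = {f. (\<forall>e. e \<notin> arcs (oruga s) \<longrightarrow> Poly_Mapping.lookup f e = 0) \<and>
     (\<forall>v\<in>verts (oruga s). net_flow f v = (if v = -1 then 1 else if v = int n then -1 else 0))}"

lemma flow_polytope_eq:
  "flow_polytope s = {f \<in> flow_space. \<forall>e\<in>arcs (oruga s). 0 \<le> Poly_Mapping.lookup f e}"
  by (auto simp: flow_polytope_def flow_space_def net_flow_def in_keys_iff)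

lemma net_flow_affine:
  "net_flow (x *\<^sub>R f + y *\<^sub>R g) v = x * net_flow f v + y * net_flow g v"
  by (simp add: net_flow_def lookup_add lookup_scaleR sum.distrib sum_distrib_left algebra_simps)

lemma affine_flow_space: "affine flow_space"
  unfolding affine_def
proof (intro ballI allI impI)
  fix f g and x y :: real
  assume "f \<in> flow_space" "g \<in> flow_space" and xy: "x + y = 1"
  have "x * d + y * d = d" for d using xy by (metis distrib_right mult_1)
  then show "x *\<^sub>R f + y *\<^sub>R g \<in> flow_space"
    using \<open>f \<in> flow_space\<close> \<open>g \<in> flow_space\<close>
    by (simp add: flow_space_def lookup_add lookup_scaleR net_flow_affine)
qed

lemma affine_hull_flow_polytope: "affine hull (flow_polytope s) \<subseteq> flow_space"
  by (rule hull_minimal) (auto simp: flow_polytope_eq affine_flow_space)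

lemma convex_flow_polytope: "convex (flow_polytope s)"
proof -
  have "convex {f :: (nat \<times> nat) \<Rightarrow>\<^sub>0 real. \<forall>e\<in>arcs (oruga s). 0 \<le> Poly_Mapping.lookup f e}"
    unfolding convex_def by (auto simp: lookup_add lookup_scaleR)
  moreover have "flow_polytope s = flow_space \<inter> {f. \<forall>e\<in>arcs (oruga s). 0 \<le> Poly_Mapping.lookup f e}"
    by (auto simp: flow_polytope_eq)
  ultimately show ?thesis by (simp add: convex_Int affine_imp_convex affine_flow_space)
qed

lemma cas_balance:
  assumes "pre_digraph.cas G u p v"
  shows "(\<Sum>e\<leftarrow>p. of_bool (tail G e = x) - of_bool (head G e = x)) =
    (of_bool (u = x) - of_bool (v = x) :: real)"
  using assms by (induction p arbitrary: u) (auto simp: pre_digraph.cas.simps)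

lemma route_indicator_in_flow_polytope:
  assumes R: "R \<in> routes s"
  shows "route_indicator R \<in> flow_polytope s"
proof -
  have arcs: "set R \<subseteq> arcs (oruga s)" by (rule routes_subset_arcs[OF R])
  have dist: "distinct R" using R by (metis routesE distinct_route_with)
  have sum: "(\<Sum>e\<in>{e \<in> arcs (oruga s). P e}. of_bool (e \<in> set R)) = (\<Sum>e\<in>set R. of_bool (P e) :: real)" for P
  proof -
    have "{e \<in> arcs (oruga s). P e} \<inter> {e. e \<in> set R} = set R \<inter> {e. P e}"
      using arcs by auto
    then show ?thesis by (simp add: finite_arcs_oruga sum_of_bool_eq)
  qed
  have "net_flow (route_indicator R) v = of_bool (-1 = v) - of_bool (int n = v)" for v
  proof -
    have "net_flow (route_indicator R) v =
        (\<Sum>e\<in>set R. of_bool (tail (oruga s) e = v) - of_bool (head (oruga s) e = v))"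
      unfolding net_flow_def lookup_route_indicator out_arcs_def in_arcs_def sum
      by (simp add: sum_subtractf)
    also have "\<dots> = (\<Sum>e\<leftarrow>R. of_bool (tail (oruga s) e = v) - of_bool (head (oruga s) e = v))"
      using dist by (simp add: sum_list_distinct_conv_sum_set)
    also have "\<dots> = of_bool (-1 = v) - of_bool (int n = v)"
      by (rule cas_balance[OF routes_cas[OF R]])
    finally show ?thesis .
  qed
  then show ?thesis
    using arcs by (auto simp: flow_polytope_eq flow_space_def lookup_route_indicator)
qed

lemma route_simplex_subset_flow_polytope:
  "C \<subseteq> routes s \<Longrightarrow> route_simplex C \<subseteq> flow_polytope s"
  unfolding route_simplex_def
  by (intro hull_minimal) (auto simp: route_indicator_in_flow_polytope convex_flow_polytope)

text \<open>The indicator of \<open>R\<close> is separated from the other routes by the total flow on the edges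
  outside \<open>R\<close>.\<close>

lemma route_indicator_in_route_simplex_iff:
  assumes C: "C \<subseteq> routes s" and R: "R \<in> routes s"
  shows "route_indicator R \<in> route_simplex C \<longleftrightarrow> R \<in> C"
proof
  assume "R \<in> C"
  then show "route_indicator R \<in> route_simplex C"
    unfolding route_simplex_def by (intro hull_inc) auto
next
  assume mem: "route_indicator R \<in> route_simplex C"
  show "R \<in> C"
  proof (rule ccontr)
    assume "R \<notin> C"
    define K where "K = {f :: (nat \<times> nat) \<Rightarrow>\<^sub>0 real.
      1 \<le> (\<Sum>e\<in>arcs (oruga s) - set R. Poly_Mapping.lookup f e)}"
    have "convex K"
      unfolding convex_def
    proof (intro ballI allI impI)
      fix f g and x y :: real
      assume fg: "f \<in> K" "g \<in> K" and xy: "0 \<le> x" "0 \<le> y" "x + y = 1"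
      let ?S = "\<lambda>f. \<Sum>e\<in>arcs (oruga s) - set R. Poly_Mapping.lookup f e"
      have "1 = x * 1 + y * 1" using xy by simp
      also have "\<dots> \<le> x * ?S f + y * ?S g"
        using fg xy unfolding K_def by (intro add_mono mult_left_mono) auto
      also have "\<dots> = ?S (x *\<^sub>R f + y *\<^sub>R g)"
        by (simp add: lookup_add lookup_scaleR sum.distrib sum_distrib_left)
      finally show "x *\<^sub>R f + y *\<^sub>R g \<in> K" by (simp add: K_def)
    qed
    moreover have "route_indicator Q \<in> K" if "Q \<in> C" for Q
    proof -
      have "\<not> set Q \<subseteq> set R" using that \<open>R \<notin> C\<close> routes_set_mono C R by blast
      then obtain e where e: "e \<in> set Q" "e \<notin> set R" by blast
      then have "e \<in> arcs (oruga s) - set R" using that C routes_subset_arcs by blast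
      then have "of_bool (e \<in> set Q) \<le> (\<Sum>e\<in>arcs (oruga s) - set R. of_bool (e \<in> set Q) :: real)"
        using finite_arcs_oruga by (intro member_le_sum) auto
      then show ?thesis using e by (simp add: K_def lookup_route_indicator)
    qed
    ultimately have "route_simplex C \<subseteq> K"
      unfolding route_simplex_def by (intro hull_minimal) auto
    then have "route_indicator R \<in> K" using mem by blast
    then show False by (simp add: K_def lookup_route_indicator)
  qed
qed

lemma route_simplex_subset_iff:
  assumes "C \<subseteq> routes s" "C' \<subseteq> routes s"
  shows "route_simplex C' \<subseteq> route_simplex C \<longleftrightarrow> C' \<subseteq> C"
proof
  assume "route_simplex C' \<subseteq> route_simplex C"
  then show "C' \<subseteq> C"
    using route_indicator_in_route_simplex_iff assms by (meson subsetD subsetI)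
next
  assume "C' \<subseteq> C"
  then show "route_simplex C' \<subseteq> route_simplex C"
    unfolding route_simplex_def by (intro hull_mono image_mono)
qed

section \<open>Interior simplices and coverage of edges\<close>

definition covering :: "(nat \<times> nat) list set \<Rightarrow> bool" where
  "covering C \<longleftrightarrow> (\<forall>e\<in>arcs (oruga s). \<exists>R\<in>C. e \<in> set R)"

lemma arc_on_route:
  assumes "e \<in> arcs (oruga s)"
  obtains R where "R \<in> routes s" "e \<in> set R"
proof -
  obtain i t where e: "e = (i, t)" by fastforce
  have it: "1 \<le> i" "i \<le> Suc n" "t \<le> part s i" "i = Suc n \<longrightarrow> t = 1"
    using assms e by (auto simp: arcs_oruga_iff)
  show ?thesis
  proof (cases "0 < t \<and> t < part s i")
    case True
    then have "route_shape i (\<lambda>a. if a = i then t else 0)"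
      using it by (auto simp: route_shape_def)
    from that[OF route_with_in_routes[OF this]] show ?thesis
      using it by (simp add: mem_route_with e)
  next
    case False
    then have "t = 0 \<or> t = part s i" using it by auto
    moreover have "i \<noteq> Suc n" using False it part_last by auto
    ultimately have "route_shape (Suc n) (\<lambda>a. if a = Suc n then 1 else if a = i then t else 0)"
      using it part_last by (auto simp: route_shape_def)
    from that[OF route_with_in_routes[OF this]] show ?thesis
      using it \<open>i \<noteq> Suc n\<close> by (simp add: mem_route_with e)
  qed
qed

text \<open>Some route uses e. Moving from f slightly away from its indicator stays in the affine
  hull but leaves the polytope.\<close>

lemma not_rel_interior_if_lookup_0:
  assumes f: "f \<in> flow_polytope s" and e: "e \<in> arcs (oruga s)" and 0: "Poly_Mapping.lookup f e = 0"
  shows "f \<notin> rel_interior (flow_polytope s)"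
proof
  assume "f \<in> rel_interior (flow_polytope s)"
  then obtain T where T: "open T" "f \<in> T" "T \<inter> affine hull (flow_polytope s) \<subseteq> flow_polytope s"
    by (auto simp: rel_interior)
  obtain R where R: "R \<in> routes s" "e \<in> set R" using arc_on_route[OF e] .
  define g where "g = route_indicator R"
  have g: "g \<in> flow_polytope s" "Poly_Mapping.lookup g e = 1"
    using R by (auto simp: g_def route_indicator_in_flow_polytope lookup_route_indicator)
  \<comment> \<open>For t > 0 this point lies beyond f on the line from g through f, and its
    coordinate at e is -t.\<close>
  define h where "h t = (1 + t) *\<^sub>R f + (- t) *\<^sub>R g" for t :: real
  have "isCont h 0" unfolding h_def by (intro continuous_intros)
  then have "(h \<longlongrightarrow> f) (at_right 0)"
    by (auto simp: isCont_def h_def intro: tendsto_within_subset)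
  then have "eventually (\<lambda>t. h t \<in> T) (at_right 0)"
    using T by (auto dest: topological_tendstoD)
  moreover have "eventually (\<lambda>t. (0::real) < t) (at_right 0)" by (simp add: eventually_at_right_less)
  ultimately have "eventually (\<lambda>t. h t \<in> T \<and> 0 < t) (at_right (0::real))" by (rule eventually_conj)
  then obtain t where t: "h t \<in> T" "0 < t"
    using eventually_happens[of _ "at_right (0::real)"] by auto
  have "h t \<in> affine hull (flow_polytope s)"
    unfolding h_def using f g
    by (intro mem_affine[OF affine_affine_hull]) (auto intro: hull_inc)
  then have "h t \<in> flow_polytope s" using T t by auto
  then have "0 \<le> Poly_Mapping.lookup (h t) e" using e by (auto simp: flow_polytope_eq)
  then show False using 0 g(2) t by (simp add: h_def lookup_add lookup_scaleR lookup_minus)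
qed

lemma rel_interior_if_lookup_pos:
  assumes f: "f \<in> flow_polytope s" and pos: "\<And>e. e \<in> arcs (oruga s) \<Longrightarrow> 0 < Poly_Mapping.lookup f e"
  shows "f \<in> rel_interior (flow_polytope s)"
proof -
  define T where "T = (\<Inter>e\<in>arcs (oruga s). {f :: (nat \<times> nat) \<Rightarrow>\<^sub>0 real. 0 < Poly_Mapping.lookup f e})"
  have "open {f :: (nat \<times> nat) \<Rightarrow>\<^sub>0 real. 0 < Poly_Mapping.lookup f e}" for e
    by (intro open_Collect_less continuous_intros linear_continuous_on bounded_linear_lookup)
  then have "open T" unfolding T_def by (intro open_INT finite_arcs_oruga) auto
  moreover have "f \<in> T" using pos by (simp add: T_def)
  moreover have "T \<inter> affine hull (flow_polytope s) \<subseteq> flow_polytope s"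
    using affine_hull_flow_polytope by (auto simp: T_def flow_polytope_eq less_imp_le)
  ultimately show ?thesis using f by (auto simp: rel_interior)
qed

text \<open>An edge avoided by all routes of C has coordinate 0 on the whole simplex, which then
  lies in the boundary. If every edge is used, the barycentre has only positive coordinates.\<close>

lemma route_simplex_interior_iff:
  assumes C: "C \<subseteq> routes s"
  shows "\<not> route_simplex C \<subseteq> rel_frontier (flow_polytope s) \<longleftrightarrow> covering C"
proof
  assume nsub: "\<not> route_simplex C \<subseteq> rel_frontier (flow_polytope s)"
  show "covering C"
  proof (rule ccontr)
    assume "\<not> covering C"
    then obtain e where e: "e \<in> arcs (oruga s)" "\<And>R. R \<in> C \<Longrightarrow> e \<notin> set R"
      by (auto simp: covering_def)
    have "route_simplex C \<subseteq> {f. Poly_Mapping.lookup f e = 0}"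
      unfolding route_simplex_def
    proof (rule hull_minimal)
      show "convex {f :: (nat \<times> nat) \<Rightarrow>\<^sub>0 real. Poly_Mapping.lookup f e = 0}"
        by (auto simp: convex_def lookup_add lookup_scaleR)
    qed (use e in \<open>auto simp: lookup_route_indicator\<close>)
    then have "route_simplex C \<subseteq> rel_frontier (flow_polytope s)"
      using route_simplex_subset_flow_polytope[OF C] not_rel_interior_if_lookup_0 e(1) closure_subset
      unfolding rel_frontier_def by blast
    with nsub show False by simp
  qed
next
  assume cov: "covering C"
  have fin: "finite C" using C finite_routes finite_subset by blast
  have "(Suc n, 1) \<in> arcs (oruga s)" using part_last by (simp add: arcs_oruga_iff)
  then have ne: "C \<noteq> {}" using cov by (auto simp: covering_def)
  define f where "f = (\<Sum>R\<in>C. (1 / real (card C)) *\<^sub>R route_indicator R)"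
  have card: "0 < card C" using fin ne by (simp add: card_gt_0_iff)
  have mem: "f \<in> route_simplex C"
    unfolding f_def route_simplex_def
    by (rule convex_sum[OF fin convex_convex_hull]) (use card in \<open>auto intro: hull_inc\<close>)
  have "f \<in> rel_interior (flow_polytope s)"
  proof (rule rel_interior_if_lookup_pos)
    show "f \<in> flow_polytope s" using mem route_simplex_subset_flow_polytope[OF C] by blast
    fix e assume "e \<in> arcs (oruga s)"
    then obtain R where R: "R \<in> C" "e \<in> set R" using cov by (auto simp: covering_def)
    have "Poly_Mapping.lookup f e = (\<Sum>R\<in>C. (1 / real (card C)) * of_bool (e \<in> set R))"
      by (simp add: f_def lookup_sum lookup_scaleR lookup_route_indicator)
    also have "\<dots> > 0" using fin R card by (intro sum_pos2[of C R]) auto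
    finally show "0 < Poly_Mapping.lookup f e" .
  qed
  then show "\<not> route_simplex C \<subseteq> rel_frontier (flow_polytope s)"
    using mem by (auto simp: rel_frontier_def)
qed

lemma interior_simplices_eq:
  "interior_simplices s = route_simplex ` {C. clique s C \<and> covering C}"
  unfolding interior_simplices_def dkk_triangulation_def
  using route_simplex_interior_iff by (auto simp: clique_def)

end

subsection \<open>Blocks, inversion numbers and transpositions\<close>

lemma length_le_if_notin:
  assumes "u' @ x = u @ a # y" "a \<notin> set u'"
  shows "length u' \<le> length u"
proof (rule ccontr)
  assume "\<not> length u' \<le> length u"
  then have "u' ! length u = (u' @ x) ! length u" "length u < length u'" by (simp_all add: nth_append)
  then have "a \<in> set u'" using assms(1) by (metis nth_append_length nth_mem)
  with assms(2) show False by simp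
qed

lemma block_ends_length_le:
  assumes eq: "u' @ B' @ v' = u @ B @ v" and "a \<notin> set u'" "a \<notin> set v'"
    and B: "B \<noteq> []" "hd B = a" "last B = a"
  shows "length u' \<le> length u" "length v' \<le> length v"
proof -
  have "u' @ (B' @ v') = u @ a # tl B @ v" using eq B by (cases B) auto
  then show "length u' \<le> length u" using assms(2) by (rule length_le_if_notin)
  have "B = butlast B @ [a]" using B by (metis append_butlast_last_id)
  then have "rev v' @ rev (u' @ B') = rev v @ a # rev (butlast B) @ rev u"
    using arg_cong[OF eq, of rev] by (metis append.assoc append_Cons append_Nil rev.simps(2) rev_append rev_rev_ident)
  then have "length (rev v') \<le> length (rev v)" by (rule length_le_if_notin) (use assms(3) in simp)
  then show "length v' \<le> length v" by simp
qed

text \<open>A shortest factor with all copies of a can be trimmed at neither end, so it starts and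
  ends with a. Conversely, every factor with all copies reaches at least as far on both
  sides.\<close>

lemma block_iff:
  assumes "a \<in> set w"
  shows "block w a u B v \<longleftrightarrow>
    w = u @ B @ v \<and> a \<notin> set u \<and> a \<notin> set v \<and> B \<noteq> [] \<and> hd B = a \<and> last B = a"
proof
  assume b: "block w a u B v"
  then have w: "w = u @ B @ v" and cnt: "count_list B a = count_list w a"
    and min: "\<And>u' B' v'. w = u' @ B' @ v' \<Longrightarrow> count_list B' a = count_list w a \<Longrightarrow> length B \<le> length B'"
    unfolding block_def by blast+
  have notin: "a \<notin> set u" "a \<notin> set v" using w cnt by (auto simp flip: count_list_0_iff)
  have ne: "B \<noteq> []" using cnt assms count_list_pos_iff[of w a] by auto
  have "hd B = a"
  proof (rule ccontr)
    assume h: "hd B \<noteq> a"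
    have "w = (u @ [hd B]) @ tl B @ v" "count_list (tl B) a = count_list w a"
      using w ne h cnt by (cases B; simp)+
    from min[OF this] show False using ne by (cases B) auto
  qed
  moreover have "last B = a"
  proof (rule ccontr)
    assume h: "last B \<noteq> a"
    have B: "B = butlast B @ [last B]" using ne by simp
    have "count_list B a = count_list (butlast B) a"
      by (subst B) (use h in simp)
    moreover have "w = u @ butlast B @ (last B # v)" using w B by (metis append.assoc append_Cons append_Nil)
    ultimately have "length B \<le> length (butlast B)" using min cnt by metis
    then show False using ne by (simp add: Suc_le_eq[symmetric] flip: length_greater_0_conv)
  qed
  ultimately show "w = u @ B @ v \<and> a \<notin> set u \<and> a \<notin> set v \<and> B \<noteq> [] \<and> hd B = a \<and> last B = a"
    using w notin ne by simp
next
  assume h: "w = u @ B @ v \<and> a \<notin> set u \<and> a \<notin> set v \<and> B \<noteq> [] \<and> hd B = a \<and> last B = a"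
  have "length B \<le> length B'" if "w = u' @ B' @ v'" "count_list B' a = count_list w a" for u' B' v'
  proof -
    have "a \<notin> set u'" "a \<notin> set v'" using that by (auto simp flip: count_list_0_iff)
    then have "length u' \<le> length u" "length v' \<le> length v"
      using block_ends_length_le[of u' B' v' u B v a] h that by auto
    moreover have "length (u' @ B' @ v') = length (u @ B @ v)" using that(1) h by metis
    ultimately show ?thesis by simp
  qed
  moreover have "count_list B a = count_list w a" using h by simp
  ultimately show "block w a u B v" unfolding block_def using h by blast
qed

lemma block_unique:
  assumes "a \<in> set w" "block w a u B v" "block w a u' B' v'"
  shows "u = u' \<and> B = B' \<and> v = v'"
proof -
  note 1 = assms(2)[unfolded block_iff[OF assms(1)]] and 2 = assms(3)[unfolded block_iff[OF assms(1)]]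
  have "length u = length u'" "length v = length v'"
    using block_ends_length_le[of u B v u' B' v' a] block_ends_length_le[of u' B' v' u B v a] 1 2
    by (simp_all add: order.antisym)
  then show ?thesis using 1 2 by (metis append_eq_append_conv)
qed

lemma block_exists:
  assumes "a \<in> set w"
  obtains u B v where "block w a u B v"
proof -
  obtain u r where u: "w = u @ a # r" "a \<notin> set u" using assms by (meson split_list_first)
  have "a \<in> set (a # r)" by simp
  then obtain x v where v: "a # r = x @ a # v" "a \<notin> set v" by (meson split_list_last)
  have "hd (x @ [a]) = a" using v by (cases x) auto
  then have "block w a u (x @ [a]) v" unfolding block_iff[OF assms] using u v by simp
  with that show ?thesis .
qed

lemma inversions_block:
  assumes "a \<in> set w" "block w a u B v"
  shows "inversions w c a = count_list u c"
proof -
  note b = assms(2)[unfolded block_iff[OF assms(1)]]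
  then have "w = u @ a # tl B @ v" by (cases B) auto
  moreover have "takeWhile (\<lambda>x. x \<noteq> a) (u @ a # y) = u" for y
    using b by (subst takeWhile_append2) auto
  ultimately show ?thesis by (simp add: inversions_def)
qed

lemma inv_num_eq_inversions:
  assumes "a \<in> set w"
  shows "inv_num w c a = inversions w c a"
  unfolding inv_num_def
  using block_exists[OF assms] inversions_block[OF assms] by (intro the_equality) metis+

section \<open>Ascents and transpositions\<close>

lemma ascents_iff:
  "(a, c) \<in> ascents w \<longleftrightarrow> a < c \<and> (\<exists>i. Suc i < length w \<and> w ! i = a \<and> w ! Suc i = c)"
proof -
  have "sublist [a, c] w \<longleftrightarrow> (\<exists>i. Suc i < length w \<and> w ! i = a \<and> w ! Suc i = c)"
  proof
    assume "sublist [a, c] w"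
    then obtain x y where "w = x @ [a, c] @ y" by (auto simp: sublist_def)
    then show "\<exists>i. Suc i < length w \<and> w ! i = a \<and> w ! Suc i = c"
      by (intro exI[of _ "length x"]) (simp add: nth_append)
  next
    assume "\<exists>i. Suc i < length w \<and> w ! i = a \<and> w ! Suc i = c"
    then obtain i where i: "Suc i < length w" "w ! i = a" "w ! Suc i = c" by blast
    have "w = take i w @ w ! i # drop (Suc i) w"
      using i by (intro id_take_nth_drop) simp
    also have "drop (Suc i) w = w ! Suc i # drop (Suc (Suc i)) w"
      by (rule Cons_nth_drop_Suc[symmetric, OF i(1)])
    finally have "w = take i w @ [w ! i, w ! Suc i] @ drop (Suc (Suc i)) w"
      by (simp only: append_Cons append_Nil)
    then show "sublist [a, c] w" unfolding sublist_def i by blast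
  qed
  then show ?thesis by (auto simp: ascents_def)
qed

text \<open>A later copy of \<open>w ! i\<close> would put the larger letter
  \<open>w ! Suc i\<close> between two copies. So the block of \<open>w ! i\<close> ends right at
  the ascent.\<close>

lemma count_list_take_ascent:
  assumes av: "avoids_121 w" and i: "Suc i < length w" "w ! i < w ! Suc i"
  shows "count_list (take (Suc i) w) (w ! i) = count_list w (w ! i)"
proof (rule ccontr)
  assume "\<not> ?thesis"
  then have "count_list (take (Suc i) w) (w ! i) < count_list w (w ! i)"
    using count_list_take_le[of "Suc i" w "w ! i"] by linarith
  then have "count_list (take (Suc (Suc i)) w) (w ! i) < count_list w (w ! i)"
    using i by (subst count_list_take_Suc) auto
  then have "count_list (take (Suc (Suc i)) w) (w ! Suc i) \<le> inversions w (w ! Suc i) (w ! i)"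
    using av i by (intro le_inversions)
  moreover have "count_list (take (Suc i) w) (w ! Suc i) = inversions w (w ! Suc i) (w ! i)"
    using av i by (intro count_eq_inversions(2)) auto
  ultimately show False using count_list_take_Suc[OF i(1), of "w ! Suc i"] by simp
qed

text \<open>The smaller letter is used up at its ascent, so it starts at most one. This identifies
  ascents, which are pairs of letters, with positions in the word.\<close>

lemma ascent_position_unique:
  assumes av: "avoids_121 w" and i: "Suc i < length w" "w ! i < w ! Suc i"
    and j: "Suc j < length w" "w ! j < w ! Suc j" and eq: "w ! i = w ! j"
  shows "i = j"
proof -
  have "\<not> i' < j'" if "Suc i' < length w" "w ! i' < w ! Suc i'" "Suc j' < length w" "w ! i' = w ! j'" for i' j'
  proof
    assume "i' < j'"
    then have "count_list (take (Suc i') w) (w ! i') \<le> count_list (take j' w) (w ! i')"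
      by (intro count_list_take_mono) simp
    moreover have "count_list (take j' w) (w ! i') < count_list w (w ! i')"
      using that by (intro count_list_take_less) auto
    ultimately show False using count_list_take_ascent[OF av that(1,2)] by simp
  qed
  from this[of i j] this[of j i] show ?thesis using assms by (metis linorder_neqE_nat)
qed

lemma transposition_ascent:
  assumes av: "avoids_121 w" and i: "Suc i < length w" "w ! i < w ! Suc i"
  obtains u B v where "w = u @ B @ w ! Suc i # v" "length (u @ B) = Suc i"
    "w ! i \<notin> set u" "w ! i \<notin> set v" "B \<noteq> []" "hd B = w ! i" "last B = w ! i"
    "transposition w (w ! i) (w ! Suc i) = u @ w ! Suc i # B @ v"
proof -
  define a c where "a = w ! i" and "c = w ! Suc i"
  have aw: "a \<in> set w" using i by (simp add: a_def)
  have tk: "take (Suc i) w = take i w @ [a]" using i by (simp add: a_def take_Suc_conv_app_nth)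
  then obtain u r where u: "take (Suc i) w = u @ a # r" "a \<notin> set u"
    by (metis in_set_conv_decomp split_list_first)
  define B v where "B = a # r" and "v = drop (Suc (Suc i)) w"
  have dr: "drop (Suc i) w = c # v" using i by (simp add: c_def v_def Cons_nth_drop_Suc)
  have w: "w = u @ B @ c # v" using append_take_drop_id[of "Suc i" w] u(1) dr by (simp add: B_def)
  have "count_list w a = count_list (take (Suc i) w) a + count_list (drop (Suc i) w) a"
    by (metis append_take_drop_id count_list_append)
  then have "count_list (c # v) a = 0"
    using count_list_take_ascent[OF av i] dr by (simp add: a_def)
  then have av': "a \<notin> set (c # v)" using count_list_0_iff[of "c # v" a] by blast
  have "last (take (Suc i) w) = a" using tk by simp
  then have last: "last B = a" using u(1) by (simp add: B_def)
  have blk: "block w a u B (c # v)"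
    unfolding block_iff[OF aw] using w u(2) av' last by (simp add: B_def)
  have tr: "transposition w a c = u @ c # B @ v"
    unfolding transposition_def
  proof (rule the_equality)
    show "\<exists>u' B' v'. block w a u' B' (c # v') \<and> u @ c # B @ v = u' @ [c] @ B' @ v'"
      using blk by auto
  next
    fix w' assume "\<exists>u B v. block w a u B (c # v) \<and> w' = u @ [c] @ B @ v"
    then show "w' = u @ c # B @ v" using block_unique[OF aw blk] by fastforce
  qed
  have "length (take (Suc i) w) = Suc i" using i by simp
  then have len: "length (u @ B) = Suc i" using u(1) by (simp add: B_def)
  have hd: "a \<notin> set v" "B \<noteq> []" "hd B = a" using av' by (simp_all add: B_def)
  from that[folded a_def c_def, OF w len u(2) hd last tr] show ?thesis .
qed

subsection \<open>Routes of prefixes\<close>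

context oruga_graph
begin

definition prefix_count :: "nat list \<Rightarrow> nat \<Rightarrow> nat" where
  "prefix_count u a = (if a = Suc n then 1 else count_list u a)"

lemma route_level_eq:
  "route_level s u =
    (if \<exists>a. a \<in> {1..n} \<and> 0 < count_list u a \<and> count_list u a < part s a
     then LEAST a. a \<in> {1..n} \<and> 0 < count_list u a \<and> count_list u a < part s a else Suc n)"
  unfolding route_level_def Bex_def by (simp only: Suc_eq_plus1)

lemma route_level_cases:
  "route_level s u = Suc n \<or> route_level s u \<in> {1..n} \<and>
    0 < count_list u (route_level s u) \<and> count_list u (route_level s u) < part s (route_level s u)"
proof -
  let ?P = "\<lambda>a. a \<in> {1..n} \<and> 0 < count_list u a \<and> count_list u a < part s a"
  show ?thesis
  proof (cases "\<exists>a. ?P a")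
    case True
    then have "?P (LEAST a. ?P a)" by (rule LeastI_ex)
    moreover have "route_level s u = (LEAST a. ?P a)" using True unfolding route_level_eq by (rule if_P)
    ultimately show ?thesis by simp
  next
    case False
    then have "route_level s u = Suc n" unfolding route_level_eq by (rule if_not_P)
    then show ?thesis by simp
  qed
qed

lemma route_level_bounds: "1 \<le> route_level s u" "route_level s u \<le> Suc n"
  using route_level_cases[of u] by auto

lemma route_level_partial:
  assumes "route_level s u \<le> n"
  shows "0 < count_list u (route_level s u) \<and> count_list u (route_level s u) < part s (route_level s u)"
  using route_level_cases[of u] assms by auto

lemma route_level_le:
  assumes "1 \<le> a" "a \<le> n" "0 < count_list u a" "count_list u a < part s a"
  shows "route_level s u \<le> a"
proof -
  let ?P = "\<lambda>a. a \<in> {1..n} \<and> 0 < count_list u a \<and> count_list u a < part s a"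
  have P: "?P a" using assms by simp
  then have "route_level s u = (LEAST a. ?P a)" unfolding route_level_eq by (intro if_P exI)
  then show ?thesis using Least_le[of ?P a, OF P] by simp
qed

lemma le_route_level_iff:
  assumes "c \<le> Suc n"
  shows "c \<le> route_level s u \<longleftrightarrow>
    (\<forall>a. 1 \<le> a \<and> a < c \<longrightarrow> \<not> (0 < count_list u a \<and> count_list u a < part s a))"
proof
  assume "c \<le> route_level s u"
  then show "\<forall>a. 1 \<le> a \<and> a < c \<longrightarrow> \<not> (0 < count_list u a \<and> count_list u a < part s a)"
    using route_level_le[of _ u] assms by fastforce
next
  assume h: "\<forall>a. 1 \<le> a \<and> a < c \<longrightarrow> \<not> (0 < count_list u a \<and> count_list u a < part s a)"
  show "c \<le> route_level s u"
    using h route_level_partial[of u] route_level_bounds[of u] assms by (meson not_less not_less_eq_eq order.trans)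
qed

lemma route_of_eq: "route_of s u = route_with (route_level s u) (prefix_count u)"
proof -
  obtain k where k: "route_level s u = Suc k" using route_level_bounds(1)[of u] by (cases "route_level s u") auto
  then have "k \<le> n" using route_level_bounds(2)[of u] by simp
  then have "route_with k (prefix_count u) = route_with k (count_list u)"
    by (intro route_with_cong) (auto simp: prefix_count_def)
  then show ?thesis
    unfolding k route_with_Suc by (simp add: route_of_def k prefix_count_def Let_def)
      (simp add: route_with_def)
qed

lemma mem_route_of:
  "(a, x) \<in> set (route_of s u) \<longleftrightarrow> 1 \<le> a \<and> a \<le> route_level s u \<and> x = prefix_count u a"
  by (simp add: route_of_eq mem_route_with)

lemma mem_route_of_letter:
  "a \<le> n \<Longrightarrow> (a, x) \<in> set (route_of s u) \<longleftrightarrow> 1 \<le> a \<and> a \<le> route_level s u \<and> x = count_list u a"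
  by (simp add: mem_route_of prefix_count_def)

lemma route_of_cong:
  assumes "\<And>a. count_list u a = count_list u' a"
  shows "route_of s u = route_of s u'"
proof -
  have "count_list u = count_list u'" using assms by (rule ext)
  then show ?thesis unfolding route_of_def route_level_def by (simp only:)
qed

text \<open>A partly used letter a keeps the route level at most a, so counts of letters above a are
  invisible to the route.\<close>

lemma route_of_cong_partial:
  assumes a: "1 \<le> a" "a \<le> n" "0 < count_list u a" "count_list u a < part s a"
    and eq: "\<And>b. b \<le> a \<Longrightarrow> count_list u b = count_list u' b"
  shows "route_of s u = route_of s u'"
proof -
  have le: "route_level s u \<le> a" "route_level s u' \<le> a"
    using route_level_le[OF a] route_level_le[of a u'] a eq[of a] by auto
  have "c \<le> route_level s u \<longleftrightarrow> c \<le> route_level s u'" if "c \<le> a" for c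
    using that a eq by (simp add: le_route_level_iff)
  then have "route_level s u = route_level s u'" using le by (metis order.antisym order.refl)
  then show ?thesis
    unfolding route_of_eq using le eq a by (auto intro!: route_with_cong simp: prefix_count_def)
qed

section \<open>Stirling permutations and the routes of their prefixes\<close>

lemma stirling_iff:
  "w \<in> stirling s \<longleftrightarrow> set w \<subseteq> {1..n} \<and> (\<forall>i\<in>{1..n}. count_list w i = part s i) \<and> avoids_121 w"
  unfolding stirling_def avoids_121_iff_nth by simp

lemma stirling_avoids: "w \<in> stirling s \<Longrightarrow> avoids_121 w"
  and stirling_count: "w \<in> stirling s \<Longrightarrow> 1 \<le> a \<Longrightarrow> a \<le> n \<Longrightarrow> count_list w a = part s a"
  and stirling_nth: "w \<in> stirling s \<Longrightarrow> i < length w \<Longrightarrow> 1 \<le> w ! i \<and> w ! i \<le> n"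
  unfolding stirling_iff using nth_mem by fastforce+

lemma stirling_mem: "w \<in> stirling s \<Longrightarrow> 1 \<le> a \<Longrightarrow> a \<le> n \<Longrightarrow> a \<in> set w"
  using part_pos[of a] stirling_count[of w a] count_list_pos_iff[of w a] by simp

lemma stirling_inv_num:
  "w \<in> stirling s \<Longrightarrow> 1 \<le> a \<Longrightarrow> a \<le> n \<Longrightarrow> inv_num w c a = inversions w c a"
  by (intro inv_num_eq_inversions stirling_mem)

lemma sum_part: "(\<Sum>i\<in>{1..n}. part s i) = sum_list s"
  by (simp add: sum.atLeast1_atMost_eq sum_list_sum_nth part_def nth_append atLeast0LessThan)

lemma length_stirling: "w \<in> stirling s \<Longrightarrow> length w = sum_list s"
  using sum_count_set[of w "{1..n}"] sum_part by (simp add: stirling_iff)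

lemma stirling_inversions_inject:
  assumes "w \<in> stirling s" "w' \<in> stirling s"
    and "\<And>a c. 1 \<le> a \<Longrightarrow> a < c \<Longrightarrow> c \<le> n \<Longrightarrow> inversions w c a = inversions w' c a"
  shows "w = w'"
proof (rule inversions_inject)
  show "count_list w a = count_list w' a" for a
  proof (cases "a \<in> {1..n}")
    case True
    then show ?thesis using assms by (simp add: stirling_count)
  next
    case False
    then have "a \<notin> set w" "a \<notin> set w'" using assms by (auto simp: stirling_iff)
    then show ?thesis by simp
  qed
  show "inversions w c a = inversions w' c a" if "a \<in> set w" "c \<in> set w" "a < c" for a c
  proof -
    have "1 \<le> a" "c \<le> n" using that assms(1) by (auto simp: stirling_iff)
    then show ?thesis using assms(3) that by simp
  qed
qed (use assms in \<open>auto simp: stirling_avoids length_stirling\<close>)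

lemma exists_stirling_with_inversions:
  assumes "\<And>a c. 1 \<le> a \<Longrightarrow> a < c \<Longrightarrow> c \<le> n \<Longrightarrow> I c a \<le> part s c"
    and "\<And>a b c. 1 \<le> a \<Longrightarrow> a < b \<Longrightarrow> b < c \<Longrightarrow> c \<le> n \<Longrightarrow> 0 < I b a \<Longrightarrow> I c b \<le> I c a"
    and "\<And>a b c. 1 \<le> a \<Longrightarrow> a < b \<Longrightarrow> b < c \<Longrightarrow> c \<le> n \<Longrightarrow> I b a < part s b \<Longrightarrow> I c a \<le> I c b"
  obtains w where "w \<in> stirling s" "\<And>a c. 1 \<le> a \<Longrightarrow> a < c \<Longrightarrow> c \<le> n \<Longrightarrow> inversions w c a = I c a"
proof (rule exists_word_with_inversions[of n "part s" I])
  fix w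
  assume "set w \<subseteq> {1..n}" "\<And>i. i \<in> {1..n} \<Longrightarrow> count_list w i = part s i" "avoids_121 w"
    and inv: "\<And>a c. 1 \<le> a \<Longrightarrow> a < c \<Longrightarrow> c \<le> n \<Longrightarrow> inversions w c a = I c a"
  then have "w \<in> stirling s" by (simp add: stirling_iff)
  then show ?thesis using that inv by blast
qed (use part_pos assms in auto)

lemma route_of_take_in_routes:
  assumes w: "w \<in> stirling s"
  shows "route_of s (take i w) \<in> routes s"
proof -
  let ?k = "route_level s (take i w)"
  have le: "count_list (take i w) a \<le> part s a" if "1 \<le> a" "a \<le> n" for a
    using count_list_take_le[of i w a] stirling_count[OF w that] by simp
  have "route_shape ?k (prefix_count (take i w))"
    unfolding route_shape_def
  proof (intro conjI allI impI)
    show "1 \<le> ?k" "?k \<le> Suc n" by (rule route_level_bounds)+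
    show "0 < prefix_count (take i w) ?k"
      using route_level_partial[of "take i w"] route_level_bounds[of "take i w"]
      by (auto simp: prefix_count_def)
    show "prefix_count (take i w) ?k < part s ?k"
      using route_level_partial[of "take i w"] route_level_bounds[of "take i w"] part_last
      by (auto simp: prefix_count_def)
    fix a assume a: "1 \<le> a \<and> a < ?k"
    then have "a \<le> n" using route_level_bounds(2)[of "take i w"] by simp
    then show "prefix_count (take i w) a = 0 \<or> prefix_count (take i w) a = part s a"
      using a le[of a] le_route_level_iff[of ?k "take i w"] route_level_bounds(2)[of "take i w"]
      by (fastforce simp: prefix_count_def)
  qed
  then show ?thesis unfolding route_of_eq by (rule route_with_in_routes)
qed

text \<open>A smaller letter partly used at this point would have copies on both sides of
  \<open>w ! i\<close>. Hence the routes just before and just after a letter both record its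
  count.\<close>

lemma letter_le_route_level:
  assumes w: "w \<in> stirling s" and i: "i < length w"
  shows "w ! i \<le> route_level s (take i w)" "w ! i \<le> route_level s (take (Suc i) w)"
proof -
  let ?c = "w ! i"
  have c: "1 \<le> ?c" "?c \<le> n" using stirling_nth[OF w i] by auto
  have key: "\<not> (0 < count_list (take i w) a \<and> count_list (take i w) a < part s a)" if a: "1 \<le> a" "a < ?c" for a
  proof
    assume h: "0 < count_list (take i w) a \<and> count_list (take i w) a < part s a"
    have "count_list (take (Suc i) w) a < count_list w a"
      using h a c i stirling_count[OF w, of a] by (simp add: count_list_take_Suc)
    then have "count_list (take (Suc i) w) ?c \<le> inversions w ?c a"
      using a stirling_avoids[OF w] by (intro le_inversions)
    moreover have "inversions w ?c a \<le> count_list (take i w) ?c" using h by (intro inversions_le) simp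
    ultimately show False using i by (simp add: count_list_take_Suc)
  qed
  have "count_list (take (Suc i) w) a = count_list (take i w) a" if "a < ?c" for a
    using that i by (simp add: count_list_take_Suc)
  then show "w ! i \<le> route_level s (take i w)" "w ! i \<le> route_level s (take (Suc i) w)"
    using key c by (simp_all add: le_route_level_iff)
qed

lemma Delta_word_eq: "length w = sum_list s \<Longrightarrow> Delta_word s w = (\<lambda>i. route_of s (take i w)) ` {..length w}"
  unfolding Delta_word_def by auto

lemma route_le_prefixes: "i \<le> j \<Longrightarrow> route_le (route_of s (take i w)) (route_of s (take j w))"
  unfolding route_le_def by (auto simp: mem_route_of prefix_count_def count_list_take_mono)

lemma clique_Delta_word: "w \<in> stirling s \<Longrightarrow> clique s (Delta_word s w)"
  unfolding clique_iff
  using route_of_take_in_routes[of w] route_le_prefixes[of _ _ w]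
  by (auto simp: Delta_word_eq length_stirling) (meson nat_le_linear)

text \<open>Prefix routes satisfy the inequalities by the two prefix bounds. Conversely, labels
  below the source-edge are 0 or full, so the inequalities are the hypotheses of
  \<open>prefix_with_counts\<close> for the labels of R.\<close>

lemma mem_Delta_word_iff:
  assumes w: "w \<in> stirling s" and R: "R \<in> routes s"
  shows "R \<in> Delta_word s w \<longleftrightarrow>
    (\<forall>a c x. 1 \<le> a \<and> a < c \<and> c \<le> n \<and> (c, x) \<in> set R \<longrightarrow>
      ((a, 0) \<in> set R \<longrightarrow> x \<le> inversions w c a) \<and>
      ((a, part s a) \<in> set R \<longrightarrow> inversions w c a \<le> x))"
    (is "_ \<longleftrightarrow> ?cond")
proof
  assume "R \<in> Delta_word s w"
  then obtain i where R: "R = route_of s (take i w)"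
    using w by (auto simp: Delta_word_eq length_stirling)
  show ?cond
  proof (intro allI impI conjI; elim conjE)
    fix a c x assume ac: "1 \<le> a" "a < c" "c \<le> n" "(c, x) \<in> set R"
    have x: "x = count_list (take i w) c" using ac R by (simp add: mem_route_of_letter)
    show "x \<le> inversions w c a" if "(a, 0) \<in> set R"
      unfolding x using that ac R part_pos[of a] stirling_count[OF w, of a] stirling_avoids[OF w]
      by (intro le_inversions) (auto simp: mem_route_of_letter)
    show "inversions w c a \<le> x" if "(a, part s a) \<in> set R"
      unfolding x using that ac R part_pos[of a]
      by (intro inversions_le) (auto simp: mem_route_of_letter)
  qed
next
  assume cond: ?cond
  obtain k f where kf: "route_shape k f" "R = route_with k f" using R by (elim routesE)
  have k: "1 \<le> k" "k \<le> Suc n" "0 < f k" "f k < part s k"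
    and f: "\<And>a. 1 \<le> a \<Longrightarrow> a < k \<Longrightarrow> f a = 0 \<or> f a = part s a"
    using kf(1) by (auto simp: route_shape_def)
  have mem: "(a, f a) \<in> set R" if "1 \<le> a" "a \<le> k" for a using that kf by (simp add: mem_route_with)
  \<comment> \<open>The letters recorded by R; index n + 1 corresponds to no letter and is cut
    off.\<close>
  let ?S = "{1..min k n}"
  obtain i where i: "i \<le> length w" "\<And>c. c \<in> ?S \<Longrightarrow> count_list (take i w) c = f c"
  proof (rule prefix_with_counts[OF stirling_avoids[OF w], of ?S f])
    show "f c \<le> count_list w c" if "c \<in> ?S" for c
      using that stirling_count[OF w, of c] f[of c] k by (cases "c = k") auto
    fix b c assume bc: "b \<in> ?S" "c \<in> ?S" "b < c"
    then have fb: "f b = 0 \<or> f b = part s b" and cnt: "count_list w b = part s b" and pos: "0 < part s b"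
      using f[of b] stirling_count[OF w, of b] part_pos[of b] by auto
    show "f c \<le> inversions w c b" if "f b < count_list w b"
      using that cond bc fb cnt mem[of b] mem[of c] by auto
    show "inversions w c b \<le> f c" if "0 < f b"
      using that cond bc fb mem[of b] mem[of c] by auto
  qed blast
  have lev: "route_level s (take i w) = k"
  proof (rule order.antisym)
    show "k \<le> route_level s (take i w)"
      using k f i(2) by (subst le_route_level_iff) fastforce+
    show "route_level s (take i w) \<le> k"
    proof (cases "k = Suc n")
      case True
      then show ?thesis by (simp add: route_level_bounds)
    next
      case False
      then show ?thesis using k i(2)[of k] by (intro route_level_le) auto
    qed
  qed
  have "f (Suc n) = 1" if "k = Suc n" using that k part_last by simp
  then have "route_of s (take i w) = R"
    unfolding route_of_eq lev kf(2) using i(2) k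
    by (intro route_with_cong) (auto simp: prefix_count_def le_Suc_eq)
  then show "R \<in> Delta_word s w" using i(1) w by (auto simp: Delta_word_eq length_stirling)
qed

subsection \<open>The cliques of faces\<close>

text \<open>Moving c before the a-block affects only prefixes ending in the block. Those ending
  strictly inside it contain some but not all copies of a, which hides c; the one ending with the
  block is the single route lost.\<close>

lemma route_of_take_in_Delta_transposition_iff:
  assumes w: "w \<in> stirling s" and i: "Suc i < length w" "w ! i < w ! Suc i" and j: "j \<le> length w"
  shows "route_of s (take j w) \<in> Delta_word s (transposition w (w ! i) (w ! Suc i)) \<longleftrightarrow> j \<noteq> Suc i"
proof -
  define a c where "a = w ! i" and "c = w ! Suc i"
  have ac: "a < c" "1 \<le> a" "a \<le> n" "c \<le> n" using i stirling_nth[OF w, of i] stirling_nth[OF w, of "Suc i"]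
    by (auto simp: a_def c_def)
  obtain u B v where uBv: "w = u @ B @ c # v" "length (u @ B) = Suc i" "a \<notin> set u" "a \<notin> set v"
    "B \<noteq> []" "hd B = a" "last B = a" and tr: "transposition w a c = u @ c # B @ v"
    using transposition_ascent[OF stirling_avoids[OF w] i] unfolding a_def c_def by metis
  define w' where "w' = u @ c # B @ v"
  have len: "length w' = length w" using uBv(1) by (simp add: w'_def)
  have mem': "route_of s (take k w') \<in> Delta_word s w'" if "k \<le> length w" for k
    using that len length_stirling[OF w] by (auto simp: Delta_word_eq)
  have cnt_a: "count_list w a = part s a" using stirling_count[OF w] ac by simp
  have "route_of s (take j w) \<in> Delta_word s w'" if "j \<noteq> Suc i"
  proof -
    consider "j \<le> length u" | "length u < j" "j < Suc i" | "Suc i < j" using \<open>j \<noteq> Suc i\<close> by linarith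
    then show ?thesis
    proof cases
      case 1
      then have "take j w = take j w'" using uBv(1) by (simp add: w'_def)
      then show ?thesis using mem'[OF j] by simp
    next
      case 2
      define B1 B2 where "B1 = take (j - length u) B" and "B2 = drop (j - length u) B"
      have B: "B = B1 @ B2" by (simp add: B1_def B2_def)
      have B1: "B1 \<noteq> []" "B2 \<noteq> []" using 2 uBv(2,5) by (auto simp: B1_def B2_def)
      have tk: "take j w = u @ B1" using 2 uBv(1,2) by (simp add: B1_def)
      have tk': "take (Suc j) w' = u @ c # B1" using 2 uBv(2) by (simp add: B1_def w'_def Suc_diff_le)
      have "a \<in> set B1" "a \<in> set B2" using B B1 uBv(5-7)
        by (metis hd_append2 hd_in_set, metis last_appendR last_in_set)
      then have p: "0 < count_list B1 a" "0 < count_list B2 a" by (simp_all add: count_list_pos_iff)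
      have "count_list w a = count_list B1 a + count_list B2 a"
        using uBv ac by (simp add: B)
      \<comment> \<open>The prefix of the new word has one more letter, c, and c > a lies above the
        level of both routes.\<close>
      then have "route_of s (u @ B1) = route_of s (u @ c # B1)"
        using p ac cnt_a uBv(3) by (intro route_of_cong_partial[of a]) auto
      then show ?thesis using mem'[of "Suc j"] 2 i tk tk' by simp
    next
      case 3
      define d where "d = j - Suc (Suc i)"
      have jd: "j = Suc (length u + length B + d)" using 3 uBv(2) by (simp add: d_def)
      have "take j w = u @ B @ c # take d v" unfolding uBv(1) jd by simp
      moreover have "take j w' = u @ c # B @ take d v" unfolding w'_def jd by simp
      ultimately have "route_of s (take j w) = route_of s (take j w')"
        by (intro route_of_cong) simp
      then show ?thesis using mem'[OF j] by simp
    qed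
  qed
  moreover have "route_of s (take (Suc i) w) \<notin> Delta_word s w'"
  proof
    assume "route_of s (take (Suc i) w) \<in> Delta_word s w'"
    then obtain k where k: "route_of s (take (Suc i) w) = route_of s (take k w')"
      using len length_stirling[OF w] by (auto simp: Delta_word_eq)
    have "a \<le> route_level s (take (Suc i) w)" "c \<le> route_level s (take (Suc i) w)"
      using letter_le_route_level[OF w, of i] letter_le_route_level[OF w i(1)] i by (auto simp: a_def c_def)
    then have "(a, count_list (take (Suc i) w) a) \<in> set (route_of s (take k w'))"
      "(c, count_list (take (Suc i) w) c) \<in> set (route_of s (take k w'))"
      using ac by (simp_all add: mem_route_of_letter flip: k)
    then have eqs: "count_list (take k w') a = count_list w a"
      "count_list (take k w') c = count_list (take (Suc i) w) c"
      using ac count_list_take_ascent[OF stirling_avoids[OF w] i] by (simp_all add: mem_route_of_letter a_def)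
    have aw: "a \<in> set w" using stirling_mem[OF w] ac by simp
    have "block w a u B (c # v)" unfolding block_iff[OF aw] using uBv ac by simp
    then have "inversions w c a = count_list u c" by (rule inversions_block[OF aw])
    then have "count_list (take (Suc i) w) c = count_list u c"
      using count_eq_inversions(2)[OF stirling_avoids[OF w] ac(1), of i] i by (simp add: a_def[symmetric])
    \<comment> \<open>In the new word one more c precedes the a-block, so a prefix with all copies
      of a contains more copies of c than the route records.\<close>
    moreover have "inversions w' c a = Suc (count_list u c)"
    proof -
      have "takeWhile (\<lambda>x. x \<noteq> a) ((u @ [c]) @ a # y) = u @ [c]" for y
        using uBv(3) ac by (subst takeWhile_append2) auto
      moreover have "w' = (u @ [c]) @ a # tl B @ v" using uBv(5,6) by (cases B) (auto simp: w'_def)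
      ultimately show ?thesis by (simp add: inversions_def)
    qed
    moreover have "inversions w' c a \<le> count_list (take k w') c"
      using eqs(1) cnt_a part_pos[of a] ac by (intro inversions_le) simp
    ultimately show False using eqs(2) by simp
  qed
  ultimately show ?thesis
    unfolding a_def[symmetric] c_def[symmetric] tr w'_def[symmetric] by auto
qed

text \<open>Lengths of the prefixes whose routes survive in the face: j is dropped when it separates
  the two letters of a pair in A. The empty and the full prefix always remain.\<close>

definition kept :: "nat list \<Rightarrow> (nat \<times> nat) set \<Rightarrow> nat set" where
  "kept w A = {j. j \<le> length w \<and> (\<forall>i. j = Suc i \<longrightarrow> Suc i < length w \<longrightarrow> (w ! i, w ! Suc i) \<notin> A)}"

lemma perm_facesD:
  assumes "(w, A) \<in> perm_faces s"
  shows "w \<in> stirling s" "A \<subseteq> ascents w" "(a, c) \<in> A \<Longrightarrow> a < c"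
    "(a, c) \<in> A \<Longrightarrow> \<exists>i. Suc i < length w \<and> w ! i = a \<and> w ! Suc i = c"
  using assms ascents_iff[of a c w] by (auto simp: perm_faces_def)

text \<open>Each transposition in the intersection removes just the prefix ending at its ascent, so
  the intersection is described by positions of w alone.\<close>

lemma Delta_face_eq:
  assumes F: "(w, A) \<in> perm_faces s"
  shows "Delta_face s (w, A) = (\<lambda>j. route_of s (take j w)) ` kept w A"
proof (cases "A = {}")
  case True
  then show ?thesis using perm_facesD(1)[OF F]
    by (auto simp: Delta_face_def kept_def Delta_word_eq length_stirling)
next
  case False
  note w = perm_facesD(1)[OF F]
  have mem: "R \<in> Delta_face s (w, A) \<longleftrightarrow>
      R \<in> Delta_word s w \<and> (\<forall>(a, c)\<in>A. R \<in> Delta_word s (transposition w a c))" for R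
    using False by (auto simp: Delta_face_def)
  have key: "(\<forall>(a, c)\<in>A. route_of s (take j w) \<in> Delta_word s (transposition w a c)) \<longleftrightarrow> j \<in> kept w A"
    if j: "j \<le> length w" for j
  proof
    assume h: "\<forall>(a, c)\<in>A. route_of s (take j w) \<in> Delta_word s (transposition w a c)"
    have False if i: "j = Suc i" "Suc i < length w" "(w ! i, w ! Suc i) \<in> A" for i
      using route_of_take_in_Delta_transposition_iff[OF w i(2) _ j] perm_facesD(3)[OF F i(3)] h i by auto
    then show "j \<in> kept w A" using j by (auto simp: kept_def)
  next
    assume h: "j \<in> kept w A"
    show "\<forall>(a, c)\<in>A. route_of s (take j w) \<in> Delta_word s (transposition w a c)"
    proof clarify
      fix a c assume ac: "(a, c) \<in> A"
      then obtain i where i: "Suc i < length w" "w ! i = a" "w ! Suc i = c"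
        using perm_facesD(4)[OF F] by blast
      then have "j \<noteq> Suc i" using h ac by (auto simp: kept_def)
      then show "route_of s (take j w) \<in> Delta_word s (transposition w a c)"
        using route_of_take_in_Delta_transposition_iff[OF w i(1) _ j] perm_facesD(3)[OF F ac] i by auto
    qed
  qed
  show ?thesis
  proof (rule set_eqI)
    fix R
    show "R \<in> Delta_face s (w, A) \<longleftrightarrow> R \<in> (\<lambda>j. route_of s (take j w)) ` kept w A"
      unfolding mem using key w by (auto simp: Delta_word_eq length_stirling kept_def)
  qed
qed

lemma clique_Delta_face:
  assumes F: "F \<in> perm_faces s"
  shows "clique s (Delta_face s F)"
proof -
  obtain w A where wA: "F = (w, A)" by fastforce
  note F = F[unfolded wA]
  have "Delta_face s (w, A) \<subseteq> Delta_word s w"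
    unfolding Delta_face_eq[OF F] using perm_facesD(1)[OF F]
    by (auto simp: Delta_word_eq length_stirling kept_def)
  then show ?thesis using clique_Delta_word[OF perm_facesD(1)[OF F]]
    unfolding wA clique_def by blast
qed

text \<open>Skipping removed prefixes only appends letters larger than the last one.\<close>

lemma kept_above:
  assumes F: "(w, A) \<in> perm_faces s" and i: "i < length w"
  obtains j where "j \<in> kept w A" "Suc i \<le> j"
    "\<And>c. c \<le> w ! i \<Longrightarrow> count_list (take j w) c = count_list (take (Suc i) w) c"
    "\<And>c. c \<le> w ! i \<Longrightarrow> c \<le> route_level s (take j w)"
proof -
  have "\<exists>j\<in>kept w A. Suc i \<le> j \<and> (\<forall>c\<le>w ! i. count_list (take j w) c = count_list (take (Suc i) w) c \<and>
      c \<le> route_level s (take j w))"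
    using i
  proof (induction "length w - i" arbitrary: i rule: less_induct)
    case less
    show ?case
    proof (cases "Suc i \<in> kept w A")
      case True
      then show ?thesis using letter_le_route_level(2)[OF perm_facesD(1)[OF F] less.prems]
        by (intro bexI[of _ "Suc i"]) auto
    next
      case False
      then have i: "Suc i < length w" "(w ! i, w ! Suc i) \<in> A" using less.prems by (auto simp: kept_def)
      then have lt: "w ! i < w ! Suc i" using perm_facesD(3)[OF F] by blast
      obtain j where j: "j \<in> kept w A" "Suc (Suc i) \<le> j" "\<And>c. c \<le> w ! Suc i \<Longrightarrow>
          count_list (take j w) c = count_list (take (Suc (Suc i)) w) c \<and> c \<le> route_level s (take j w)"
      proof -
        have "length w - Suc i < length w - i" using i by simp
        from less.hyps[OF this i(1)] that show ?thesis by blast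
      qed
      then show ?thesis
        using lt i(1) by (intro bexI[of _ j]) (auto simp: count_list_take_Suc[OF i(1)])
    qed
  qed
  then show ?thesis using that by blast
qed

text \<open>The empty prefix provides the labels 0 and the edge of index n + 1, the whole word the
  full labels. For a partial label t take the prefix ending with the t-th copy of i: further copies
  follow, so no ascent starts there and the prefix is kept.\<close>

lemma covering_Delta_face:
  assumes "F \<in> perm_faces s"
  shows "covering (Delta_face s F)"
proof -
  obtain w A where wA: "F = (w, A)" by fastforce
  note F = assms[unfolded wA]
  note w = perm_facesD(1)[OF F]
  have "\<exists>j\<in>kept w A. (i, t) \<in> set (route_of s (take j w))"
    if it: "1 \<le> i" "i \<le> Suc n" "t \<le> part s i" "i = Suc n \<longrightarrow> t = 1" for i t
  proof (cases "i = Suc n \<or> t = 0")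
    case True
    have "Suc n \<le> route_level s []" by (subst le_route_level_iff) auto
    then have "(i, t) \<in> set (route_of s (take 0 w))"
      using True it by (auto simp: mem_route_of prefix_count_def)
    moreover have "0 \<in> kept w A" by (simp add: kept_def)
    ultimately show ?thesis by blast
  next
    case False
    then have i: "i \<le> n" "0 < t" using it by auto
    show ?thesis
    proof (cases "t = part s i")
      case True
      have "Suc n \<le> route_level s (take (length w) w)"
        using stirling_count[OF w] by (subst le_route_level_iff) auto
      then have "(i, t) \<in> set (route_of s (take (length w) w))"
        using True it i stirling_count[OF w, of i] by (simp add: mem_route_of_letter)
      moreover have "length w \<in> kept w A" by (simp add: kept_def)
      ultimately show ?thesis by blast
    next
      case False
      then have lt: "t < part s i" using it by simp
      obtain k where k: "k < length w" "w ! k = i" "count_list (take (Suc k) w) i = t"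
        using count_list_take_nth[of t w i] i lt stirling_count[OF w it(1) i(1)] by auto
      have "(i, t) \<in> set (route_of s (take (Suc k) w))"
        using letter_le_route_level(2)[OF w k(1)] k it i by (simp add: mem_route_of_letter)
      moreover have "(w ! k, w ! Suc k) \<notin> A" if "Suc k < length w"
      proof
        assume "(w ! k, w ! Suc k) \<in> A"
        then have "w ! k < w ! Suc k" using perm_facesD(3)[OF F] by blast
        then show False
          using count_list_take_ascent[OF stirling_avoids[OF w] that] k lt stirling_count[OF w it(1) i(1)] by simp
      qed
      then have "Suc k \<in> kept w A" using k(1) by (auto simp: kept_def)
      ultimately show ?thesis by blast
    qed
  qed
  then show ?thesis
    unfolding covering_def wA Delta_face_eq[OF F] by (auto simp: arcs_oruga_iff)
qed

end

subsection \<open>The interval of words spanned by a clique\<close>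

context oruga_graph
begin

text \<open>For the clique of a face \<open>(w, A)\<close> these are the inversion numbers of \<open>w\<close> and of
  \<open>w + A\<close>. The inserted bounds only matter when no route qualifies.\<close>

definition lower :: "(nat \<times> nat) list set \<Rightarrow> nat \<Rightarrow> nat \<Rightarrow> nat" where
  "lower C c a = Max (insert 0 {x. \<exists>R\<in>C. (c, x) \<in> set R \<and> (a, 0) \<in> set R})"

definition upper :: "(nat \<times> nat) list set \<Rightarrow> nat \<Rightarrow> nat \<Rightarrow> nat" where
  "upper C c a = Min (insert (part s c) {x. \<exists>R\<in>C. (c, x) \<in> set R \<and> (a, part s a) \<in> set R})"

lemma finite_route_values:
  "C \<subseteq> routes s \<Longrightarrow> finite {x. \<exists>R\<in>C. (c, x) \<in> set R \<and> P R}"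
  by (rule finite_subset[of _ "{..part s c}"]) (use routes_range in blast, simp)

lemma le_lower:
  "C \<subseteq> routes s \<Longrightarrow> R \<in> C \<Longrightarrow> (c, x) \<in> set R \<Longrightarrow> (a, 0) \<in> set R \<Longrightarrow> x \<le> lower C c a"
  unfolding lower_def by (intro Max_ge) (auto simp: finite_route_values)

lemma upper_le:
  "C \<subseteq> routes s \<Longrightarrow> R \<in> C \<Longrightarrow> (c, x) \<in> set R \<Longrightarrow> (a, part s a) \<in> set R \<Longrightarrow> upper C c a \<le> x"
  unfolding upper_def by (intro Min_le) (auto simp: finite_route_values)

lemma lower_cases:
  assumes "C \<subseteq> routes s"
  obtains "lower C c a = 0" | R where "R \<in> C" "(c, lower C c a) \<in> set R" "(a, 0) \<in> set R"
proof -
  have "lower C c a \<in> insert 0 {x. \<exists>R\<in>C. (c, x) \<in> set R \<and> (a, 0) \<in> set R}"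
    unfolding lower_def by (rule Max_in) (auto simp: finite_route_values[OF assms])
  then show ?thesis using that by blast
qed

lemma upper_cases:
  assumes "C \<subseteq> routes s"
  obtains "upper C c a = part s c"
  | R where "R \<in> C" "(c, upper C c a) \<in> set R" "(a, part s a) \<in> set R"
proof -
  have "upper C c a \<in> insert (part s c) {x. \<exists>R\<in>C. (c, x) \<in> set R \<and> (a, part s a) \<in> set R}"
    unfolding upper_def by (rule Min_in) (auto simp: finite_route_values[OF assms])
  then show ?thesis using that by blast
qed

lemma lower_le_part: "C \<subseteq> routes s \<Longrightarrow> lower C c a \<le> part s c"
  by (rule lower_cases[of C c a]) (use routes_range in auto)

lemma upper_le_part: "C \<subseteq> routes s \<Longrightarrow> upper C c a \<le> part s c"
  unfolding upper_def by (intro Min_le) (auto simp: finite_route_values)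

lemma clique_route_le:
  assumes "clique s C" "Q \<in> C" "R \<in> C" "(b, x) \<in> set Q" "(b, y) \<in> set R" "x < y"
  shows "route_le Q R"
proof -
  have "\<not> route_le R Q" using assms(4-6) unfolding route_le_def by (meson not_le)
  then show ?thesis using assms(1-3) unfolding clique_iff by blast
qed

text \<open>A route with label 0 at a lies below one with full label at a, so their labels at c are
  ordered too.\<close>

lemma lower_le:
  assumes C: "clique s C" and R: "R \<in> C" "(c, x) \<in> set R" "(a, part s a) \<in> set R"
  shows "lower C c a \<le> x"
proof -
  have sub: "C \<subseteq> routes s" using C by (simp add: clique_def)
  have a: "0 < part s a" using R sub routes_range[of R a "part s a"] part_pos by blast
  show ?thesis
  proof (rule lower_cases[OF sub, of c a])
    fix Q assume Q: "Q \<in> C" "(c, lower C c a) \<in> set Q" "(a, 0) \<in> set Q"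
    then have "route_le Q R" using clique_route_le[OF C Q(1) R(1) Q(3) R(3) a] by simp
    then show ?thesis using Q(2) R(2) unfolding route_le_def by blast
  qed simp
qed

text \<open>A route attaining \<open>lower C c b\<close> has label 0 at b, so it lies below a route
  with positive label at b and label 0 at a. It cannot be full at a, hence is 0 there and competes
  in \<open>lower C c a\<close>.\<close>

lemma lower_transitive:
  assumes C: "clique s C" and abc: "1 \<le> a" "a < b" "b < c" "c \<le> n" and pos: "0 < lower C b a"
  shows "lower C c b \<le> lower C c a"
proof -
  have sub: "C \<subseteq> routes s" using C by (simp add: clique_def)
  have a: "0 < part s a" using abc part_pos[of a] by simp
  obtain R where R: "R \<in> C" "(b, lower C b a) \<in> set R" "(a, 0) \<in> set R"
    by (rule lower_cases[OF sub, of b a]) (use pos in auto)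
  show ?thesis
  proof (rule lower_cases[OF sub, of c b])
    fix Q assume Q: "Q \<in> C" "(c, lower C c b) \<in> set Q" "(b, 0) \<in> set Q"
    have "route_le Q R" using clique_route_le[OF C Q(1) R(1) Q(3) R(2) pos] .
    then have "(a, part s a) \<notin> set Q" using R(3) a unfolding route_le_def by (meson not_le)
    then have "(a, 0) \<in> set Q" using routes_below[of Q b 0 a] Q sub abc by blast
    then show ?thesis using le_lower[OF sub Q(1,2)] by simp
  qed simp
qed

text \<open>A route attaining \<open>lower C c a\<close> has label at most
  \<open>lower C b a\<close> at b, which is not full. Below c labels are 0 or full, so it is 0 at b
  and competes in \<open>lower C c b\<close>.\<close>

lemma lower_planar:
  assumes C: "clique s C" and abc: "1 \<le> a" "a < b" "b < c" "c \<le> n" and lt: "lower C b a < part s b"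
  shows "lower C c a \<le> lower C c b"
proof -
  have sub: "C \<subseteq> routes s" using C by (simp add: clique_def)
  show ?thesis
  proof (rule lower_cases[OF sub, of c a])
    fix Q assume Q: "Q \<in> C" "(c, lower C c a) \<in> set Q" "(a, 0) \<in> set Q"
    have "(b, part s b) \<notin> set Q" using le_lower[OF sub Q(1) _ Q(3)] lt by (meson not_le)
    then have "(b, 0) \<in> set Q" using routes_below[OF _ Q(2), of b] Q(1) sub abc by auto
    then show ?thesis using le_lower[OF sub Q(1,2)] by simp
  qed simp
qed

text \<open>Exchanging 0 with the full label and reversing the order swaps transitivity and
  planarity: the argument is dual to \<open>lower_planar\<close>, and that of
  \<open>upper_planar\<close> to \<open>lower_transitive\<close>.\<close>

lemma upper_transitive:
  assumes C: "clique s C" and abc: "1 \<le> a" "a < b" "b < c" "c \<le> n" and pos: "0 < upper C b a"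
  shows "upper C c b \<le> upper C c a"
proof -
  have sub: "C \<subseteq> routes s" using C by (simp add: clique_def)
  show ?thesis
  proof (rule upper_cases[OF sub, of c a])
    fix Q assume Q: "Q \<in> C" "(c, upper C c a) \<in> set Q" "(a, part s a) \<in> set Q"
    have "(b, 0) \<notin> set Q" using upper_le[OF sub Q(1) _ Q(3)] pos by (meson not_le)
    then have "(b, part s b) \<in> set Q" using routes_below[OF _ Q(2), of b] Q(1) sub abc by auto
    then show ?thesis using upper_le[OF sub Q(1,2)] by simp
  qed (simp add: upper_le_part[OF sub])
qed

lemma upper_planar:
  assumes C: "clique s C" and abc: "1 \<le> a" "a < b" "b < c" "c \<le> n" and lt: "upper C b a < part s b"
  shows "upper C c a \<le> upper C c b"
proof -
  have sub: "C \<subseteq> routes s" using C by (simp add: clique_def)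
  have a: "0 < part s a" using abc part_pos[of a] by simp
  obtain R where R: "R \<in> C" "(b, upper C b a) \<in> set R" "(a, part s a) \<in> set R"
    by (rule upper_cases[OF sub, of b a]) (use lt in auto)
  show ?thesis
  proof (rule upper_cases[OF sub, of c b])
    fix Q assume Q: "Q \<in> C" "(c, upper C c b) \<in> set Q" "(b, part s b) \<in> set Q"
    have "route_le R Q" using clique_route_le[OF C R(1) Q(1) R(2) Q(3) lt] .
    then have "(a, 0) \<notin> set Q" using R(3) a unfolding route_le_def by (meson not_le)
    then have "(a, part s a) \<in> set Q" using routes_below[of Q b "part s b" a] Q sub abc by blast
    then show ?thesis using upper_le[OF sub Q(1,2)] by simp
  qed (simp add: upper_le_part[OF sub])
qed

text \<open>A prefix without a contains only copies of c standing before the a-block. The last such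
  copy attains the bound: the kept prefix supplied by \<open>kept_above\<close> still has no a and
  records c.\<close>

lemma lower_Delta_face:
  assumes F: "(w, A) \<in> perm_faces s" and ac: "1 \<le> a" "a < c" "c \<le> n"
  shows "lower (Delta_face s (w, A)) c a = inversions w c a"
proof (rule order.antisym)
  let ?C = "Delta_face s (w, A)"
  note w = perm_facesD(1)[OF F] and av = stirling_avoids[OF perm_facesD(1)[OF F]]
  have sub: "?C \<subseteq> routes s" using clique_Delta_face[OF F] by (simp add: clique_def)
  have cnt: "count_list w a = part s a" "0 < part s a"
    using stirling_count[OF w, of a] part_pos[of a] ac by auto
  show "lower ?C c a \<le> inversions w c a"
  proof (rule lower_cases[OF sub, of c a])
    fix R assume R: "R \<in> ?C" "(c, lower ?C c a) \<in> set R" "(a, 0) \<in> set R"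
    then obtain j where "R = route_of s (take j w)" unfolding Delta_face_eq[OF F] by blast
    then have "lower ?C c a = count_list (take j w) c" "count_list (take j w) a = 0"
      using R ac by (simp_all add: mem_route_of_letter)
    then show ?thesis using le_inversions[OF av ac(2), of j] cnt by simp
  qed simp
  show "inversions w c a \<le> lower ?C c a"
  proof (cases "inversions w c a = 0")
    case False
    then obtain i where i: "i < length w" "w ! i = c" "count_list (take (Suc i) w) c = inversions w c a"
      using count_list_take_nth[of "inversions w c a" w c] inversions_le_count[of w c a] by blast
    obtain j where j: "j \<in> kept w A" "count_list (take j w) c = count_list (take (Suc i) w) c"
      "count_list (take j w) a = count_list (take (Suc i) w) a" "c \<le> route_level s (take j w)"
      using kept_above[OF F i(1)] i(2) ac by (metis less_imp_le order.refl)
    have "count_list (take (Suc i) w) a = 0"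
    proof (rule ccontr)
      assume "count_list (take (Suc i) w) a \<noteq> 0"
      then have "0 < count_list (take i w) a" using i ac by (simp add: count_list_take_Suc)
      then have "inversions w c a \<le> count_list (take i w) c" by (rule inversions_le)
      then show False using i by (simp add: count_list_take_Suc)
    qed
    then have "(c, inversions w c a) \<in> set (route_of s (take j w))" "(a, 0) \<in> set (route_of s (take j w))"
      using j i ac by (simp_all add: mem_route_of_letter)
    then show ?thesis using le_lower[OF sub] j(1) unfolding Delta_face_eq[OF F] by blast
  qed simp
qed

text \<open>A prefix with all copies of a contains every c before the a-block. If (a, c) is in A,
  the prefix ending with the block is dropped, and every longer one contains the c that
  follows.\<close>

lemma upper_Delta_face_ge:
  assumes F: "(w, A) \<in> perm_faces s" and ac: "1 \<le> a" "a < c" "c \<le> n"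
  shows "inversions w c a + of_bool ((a, c) \<in> A) \<le> upper (Delta_face s (w, A)) c a"
proof -
  let ?C = "Delta_face s (w, A)"
  note w = perm_facesD(1)[OF F] and av = stirling_avoids[OF perm_facesD(1)[OF F]]
  have sub: "?C \<subseteq> routes s" using clique_Delta_face[OF F] by (simp add: clique_def)
  have cnt: "count_list w a = part s a" "count_list w c = part s c" "0 < part s a"
    using stirling_count[OF w, of a] stirling_count[OF w, of c] part_pos[of a] ac by auto
  have asc: "\<exists>i. Suc i < length w \<and> w ! i = a \<and> w ! Suc i = c \<and>
      count_list (take (Suc i) w) c = inversions w c a" if "(a, c) \<in> A"
    using perm_facesD(4)[OF F that] count_eq_inversions(2)[OF av ac(2)] by (metis Suc_lessD)
  show ?thesis
  proof (rule upper_cases[OF sub, of c a])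
    \<comment> \<open>The default value leaves room for the extra 1, since the c of the ascent comes
      after the block.\<close>
    assume u: "upper ?C c a = part s c"
    show ?thesis
    proof (cases "(a, c) \<in> A")
      case True
      then obtain i where "Suc i < length w" "w ! Suc i = c" "count_list (take (Suc i) w) c = inversions w c a"
        using asc by blast
      then show ?thesis using count_list_take_less[of "Suc i" w c] cnt u True by simp
    next
      case False
      then show ?thesis using inversions_le_count[of w c a] cnt u by simp
    qed
  next
    fix R assume R: "R \<in> ?C" "(c, upper ?C c a) \<in> set R" "(a, part s a) \<in> set R"
    then obtain j where j: "j \<in> kept w A" "R = route_of s (take j w)" unfolding Delta_face_eq[OF F] by blast
    have u: "upper ?C c a = count_list (take j w) c" and ja: "count_list (take j w) a = part s a"
      using R j(2) ac by (simp_all add: mem_route_of_letter)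
    show ?thesis
    proof (cases "(a, c) \<in> A")
      case True
      then obtain i where i: "Suc i < length w" "w ! i = a" "w ! Suc i = c"
          "count_list (take (Suc i) w) c = inversions w c a"
        using asc by blast
      have "\<not> j \<le> i"
        using count_list_take_mono[of j i w a] count_list_take_less[of i w a] i cnt ja by auto
      moreover have "j \<noteq> Suc i" using j(1) i True by (auto simp: kept_def)
      ultimately have "count_list (take (Suc (Suc i)) w) c \<le> count_list (take j w) c"
        by (intro count_list_take_mono) simp
      then show ?thesis using i True u by (simp add: count_list_take_Suc)
    next
      case False
      then show ?thesis using inversions_le[of j w a c] ja cnt u by simp
    qed
  qed
qed

text \<open>This is the minimality of \<open>upper\<close>. The natural witness is the prefix ending
  with the last a. If it is hidden or dropped, either an intermediate letter b with I(b,a) > 0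
  reduces (a, c) to (b, c), or the next kept prefix serves.\<close>

lemma kept_below_transitive_above:
  assumes F: "(w, A) \<in> perm_faces s" and I: "transitive_above s w A I"
    and ac: "1 \<le> a" "a < c" "c \<le> n"
  shows "\<exists>j\<in>kept w A. c \<le> route_level s (take j w) \<and> count_list (take j w) a = part s a \<and>
    count_list (take j w) c \<le> I c a"
  using ac
proof (induction "c - a" arbitrary: a rule: less_induct)
  case less
  note ac = less.prems
  note w = perm_facesD(1)[OF F] and av = stirling_avoids[OF perm_facesD(1)[OF F]]
  have Ige: "inversions w c' a' + of_bool ((a', c') \<in> A) \<le> I c' a'" if "1 \<le> a'" "a' < c'" "c' \<le> n" for a' c'
  proof -
    have "inv_num w c' a' = inversions w c' a'" using that by (intro stirling_inv_num[OF w]) auto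
    moreover have "inv_num w c' a' + of_bool ((a', c') \<in> A) \<le> I c' a'"
      using I that unfolding transitive_above_def by blast
    ultimately show ?thesis by simp
  qed
  have Itr: "I b a = 0 \<or> I c b \<le> I c a" if "a < b" "b < c" for b
    using I that ac unfolding transitive_above_def by blast
  have cnt: "count_list w a = part s a" "0 < part s a"
    using stirling_count[OF w, of a] part_pos[of a] ac by auto
  obtain i where i: "i < length w" "w ! i = a" "count_list (take (Suc i) w) a = part s a"
    using count_list_take_nth[of "part s a" w a] cnt by auto
  have full: "count_list (take j w) a = part s a" if "Suc i \<le> j" for j
    using count_list_take_mono[OF that, of w a] count_list_take_le[of j w a] i(3) cnt(1) by simp
  have ic: "count_list (take (Suc i) w) c' = inversions w c' a" if "a < c'" for c'
    using count_eq_inversions(2)[OF av that i(1,2)] .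
  \<comment> \<open>The prefix found for (b, c) contains all copies of b, so it reaches past the
    last a; its count of c is at most I(c,b) \<le> I(c,a).\<close>
  have step: ?case if b: "a < b" "b < c" "0 < I b a" "count_list (take (Suc i) w) b < part s b" for b
  proof -
    obtain j where j: "j \<in> kept w A" "c \<le> route_level s (take j w)" "count_list (take j w) b = part s b"
      "count_list (take j w) c \<le> I c b"
      using less.hyps[of b] b ac by (metis diff_less_mono2 less_imp_le order.strict_trans1)
    have "Suc i \<le> j"
      using count_list_take_mono[of j "Suc i" w b] b(4) j(3) by (metis nat_le_linear not_le)
    moreover have "count_list (take j w) c \<le> I c a" using j(4) Itr[OF b(1,2)] b(3) by simp
    ultimately show ?thesis using j full by blast
  qed
  have al: "a \<le> route_level s (take (Suc i) w)" using letter_le_route_level(2)[OF w i(1)] i(2) by simp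
  consider (level) "route_level s (take (Suc i) w) < c"
    | (keep) "c \<le> route_level s (take (Suc i) w)" "Suc i \<in> kept w A"
    | (drop) "Suc i \<notin> kept w A" by linarith
  then show ?case
  proof cases
    case level
    \<comment> \<open>The partly used letter b hides c. Its count here is its inversion number over
      a, so I(b,a) is positive.\<close>
    define b where "b = route_level s (take (Suc i) w)"
    have p: "0 < count_list (take (Suc i) w) b" "count_list (take (Suc i) w) b < part s b"
      using route_level_partial[of "take (Suc i) w"] level ac by (auto simp: b_def)
    then have ab: "a < b" using al i(3) by (cases "a = b") (auto simp: b_def)
    have "0 < I b a" using p(1) ic[OF ab] Ige[of a b] ab level ac by (simp add: b_def)
    then show ?thesis using step ab p(2) level by (simp add: b_def)
  next
    case keep
    then show ?thesis using ic[OF ac(2)] Ige[OF ac] i(3) by (intro bexI[of _ "Suc i"]) auto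
  next
    case drop
    then have si: "Suc i < length w" "(a, w ! Suc i) \<in> A" using i by (auto simp: kept_def)
    \<comment> \<open>Membership of (a, b) in A makes I(b,a) positive. If b \<ge> c, the next kept
      prefix gains a c only when b = c, and then I(c,a) includes that extra 1.\<close>
    define b where "b = w ! Suc i"
    have ab: "a < b" "b \<le> n" "(a, b) \<in> A" using si perm_facesD(3)[OF F] stirling_nth[OF w si(1)] by (auto simp: b_def)
    show ?thesis
    proof (cases "b < c")
      case True
      have "0 < I b a" using Ige[of a b] ab ac by simp
      moreover have "count_list (take (Suc i) w) b < part s b"
        using count_list_take_less[OF si(1)] stirling_count[OF w, of b] ab ac by (simp add: b_def)
      ultimately show ?thesis using step ab True by blast
    next
      case False
      then have cb: "c \<le> w ! Suc i" by (simp add: b_def)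
      obtain j where j: "j \<in> kept w A" "Suc (Suc i) \<le> j"
        "count_list (take j w) c = count_list (take (Suc (Suc i)) w) c" "c \<le> route_level s (take j w)"
        using kept_above[OF F si(1)] cb by metis
      have "count_list (take (Suc (Suc i)) w) c = inversions w c a + (if b = c then 1 else 0)"
        using ic[OF ac(2)] count_list_take_Suc[OF si(1), of c] by (simp add: b_def)
      also have "\<dots> \<le> I c a" using Ige[OF ac] ab by auto
      finally show ?thesis using j full[of j] by (intro bexI[of _ j]) auto
    qed
  qed
qed

section \<open>The word obtained by adding ascents\<close>

lemma transitive_above_upper:
  assumes F: "(w, A) \<in> perm_faces s"
    and I: "\<And>a c. 1 \<le> a \<Longrightarrow> a < c \<Longrightarrow> c \<le> n \<Longrightarrow> I c a = upper (Delta_face s (w, A)) c a"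
  shows "transitive_above s w A I"
  unfolding transitive_above_def
proof (intro conjI allI impI)
  fix a c assume "1 \<le> a \<and> a < c \<and> c \<le> n"
  then show "inv_num w c a + of_bool ((a, c) \<in> A) \<le> I c a"
    using upper_Delta_face_ge[OF F, of a c] I[of a c] stirling_inv_num[OF perm_facesD(1)[OF F], of a c] by simp
next
  fix a b c assume abc: "1 \<le> a \<and> a < b \<and> b < c \<and> c \<le> n"
  then have "I b a = upper (Delta_face s (w, A)) b a" "I c a = upper (Delta_face s (w, A)) c a"
    "I c b = upper (Delta_face s (w, A)) c b"
    using I[of a b] I[of a c] I[of b c] by auto
  then show "I b a = 0 \<or> I c b \<le> I c a"
    using upper_transitive[OF clique_Delta_face[OF F], of a b c] abc by auto
qed

lemma upper_le_transitive_above: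
  assumes F: "(w, A) \<in> perm_faces s" and I: "transitive_above s w A I"
    and ac: "1 \<le> a" "a < c" "c \<le> n"
  shows "upper (Delta_face s (w, A)) c a \<le> I c a"
proof -
  obtain j where j: "j \<in> kept w A" "c \<le> route_level s (take j w)" "count_list (take j w) a = part s a"
    "count_list (take j w) c \<le> I c a"
    using kept_below_transitive_above[OF F I ac] by blast
  have "upper (Delta_face s (w, A)) c a \<le> count_list (take j w) c"
    using j ac clique_Delta_face[OF F]
    by (intro upper_le[of _ "route_of s (take j w)"])
      (auto simp: Delta_face_eq[OF F] clique_def mem_route_of_letter)
  then show ?thesis using j(4) by simp
qed

text \<open>\<open>upper\<close> is the least admissible function and, being transitive and planar,
  is realised by a word. The definite description is resolved because two least functions agree and
  inversion numbers determine the word.\<close>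

lemma add_ascents_stirling:
  assumes F: "(w, A) \<in> perm_faces s"
  shows "add_ascents s w A \<in> stirling s \<and> (\<forall>a c. 1 \<le> a \<and> a < c \<and> c \<le> n \<longrightarrow>
    inversions (add_ascents s w A) c a = upper (Delta_face s (w, A)) c a)"
proof -
  let ?U = "upper (Delta_face s (w, A))"
  note cl = clique_Delta_face[OF F]
  have sub: "Delta_face s (w, A) \<subseteq> routes s" using cl by (simp add: clique_def)
  obtain z where z: "z \<in> stirling s" "\<And>a c. 1 \<le> a \<Longrightarrow> a < c \<Longrightarrow> c \<le> n \<Longrightarrow> inversions z c a = ?U c a"
    using exists_stirling_with_inversions[of ?U] upper_le_part[OF sub] upper_transitive[OF cl] upper_planar[OF cl]
    by blast
  have zi: "inv_num z c a = ?U c a" if "1 \<le> a" "a < c" "c \<le> n" for a c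
    using z that stirling_inv_num[OF z(1), of a c] by simp
  have "add_ascents s w A = z"
    unfolding add_ascents_def
  proof (rule the_equality, intro conjI allI impI)
    show "z \<in> stirling s" by (rule z)
    show "transitive_above s w A (inv_num z)" using zi by (rule transitive_above_upper[OF F])
    show "inv_num z c a \<le> I c a" if "transitive_above s w A I" "1 \<le> a \<and> a < c \<and> c \<le> n" for I a c
      using upper_le_transitive_above[OF F that(1), of a c] zi[of a c] that(2) by simp
  next
    fix z' assume h: "z' \<in> stirling s \<and> transitive_above s w A (inv_num z') \<and>
      (\<forall>I. transitive_above s w A I \<longrightarrow>
        (\<forall>a c. 1 \<le> a \<and> a < c \<and> c \<le> n \<longrightarrow> inv_num z' c a \<le> I c a))"
    show "z' = z"
    proof (rule stirling_inversions_inject)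
      fix a c :: nat assume ac: "1 \<le> a" "a < c" "c \<le> n"
      have "inv_num z' c a \<le> inv_num z c a" using h transitive_above_upper[OF F zi] ac by blast
      moreover have "inv_num z c a \<le> inv_num z' c a"
        using upper_le_transitive_above[OF F, of "inv_num z'" a c] h zi[OF ac] ac by simp
      ultimately show "inversions z' c a = inversions z c a"
        using h z(1) ac stirling_inv_num[of z' a c] stirling_inv_num[of z a c] by simp
    qed (use h z in auto)
  qed
  then show ?thesis using z by simp
qed

subsection \<open>Faces and covering cliques\<close>

text \<open>The word realising \<open>lower C\<close> is the only candidate, and all routes of C
  come from its prefixes. A collects the ascents whose prefix routes are missing; the work is to
  show that no other prefix route is missing.\<close>

lemma covering_clique_is_face:
  assumes C: "clique s C" and cov: "covering C"
  obtains F where "F \<in> perm_faces s" "C = Delta_face s F"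
proof -
  have sub: "C \<subseteq> routes s" using C by (simp add: clique_def)
  obtain w where w: "w \<in> stirling s"
    and inv: "\<And>a c. 1 \<le> a \<Longrightarrow> a < c \<Longrightarrow> c \<le> n \<Longrightarrow> inversions w c a = lower C c a"
    using exists_stirling_with_inversions[of "lower C"] lower_le_part[OF sub] lower_transitive[OF C] lower_planar[OF C]
    by blast
  note av = stirling_avoids[OF w]
  define A where "A = {(w ! i, w ! Suc i) | i. Suc i < length w \<and> w ! i < w ! Suc i \<and>
    route_of s (take (Suc i) w) \<notin> C}"
  have F: "(w, A) \<in> perm_faces s"
    using w by (auto simp: perm_faces_def A_def ascents_iff)
  have in_Delta: "\<exists>i\<le>length w. R = route_of s (take i w)" if R: "R \<in> C" for R
  proof -
    have "R \<in> Delta_word s w"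
      using mem_Delta_word_iff[OF w, of R] R sub inv le_lower[OF sub R] lower_le[OF C R] by auto
    then show ?thesis using w by (auto simp: Delta_word_eq length_stirling)
  qed
  have covers: "\<exists>i\<le>length w. route_of s (take i w) \<in> C \<and> count_list (take i w) x = t"
    if "1 \<le> x" "x \<le> n" "t \<le> part s x" for x t
  proof -
    have "(x, t) \<in> arcs (oruga s)" using that by (simp add: arcs_oruga_iff)
    then obtain R where R: "R \<in> C" "(x, t) \<in> set R" using cov by (auto simp: covering_def)
    then show ?thesis using in_Delta[OF R(1)] that by (auto simp: mem_route_of_letter)
  qed
  have "C = (\<lambda>j. route_of s (take j w)) ` kept w A"
  proof (intro set_eqI iffI)
    fix R assume R: "R \<in> C"
    then obtain j where j: "j \<le> length w" "R = route_of s (take j w)" using in_Delta by blast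
    have "(w ! i, w ! Suc i) \<notin> A" if i: "j = Suc i" "Suc i < length w" for i
    proof
      assume "(w ! i, w ! Suc i) \<in> A"
      then obtain i' where i': "Suc i' < length w" "w ! i' < w ! Suc i'" "route_of s (take (Suc i') w) \<notin> C"
        "w ! i = w ! i'" "w ! Suc i = w ! Suc i'" by (auto simp: A_def)
      \<comment> \<open>A records pairs of letters; uniqueness of the position of an ascent carries
        the missing route back to i.\<close>
      then have "i = i'" using ascent_position_unique[OF av] i by metis
      then show False using i' R j i by simp
    qed
    then show "R \<in> (\<lambda>j. route_of s (take j w)) ` kept w A" using j by (auto simp: kept_def)
  next
    fix R assume "R \<in> (\<lambda>j. route_of s (take j w)) ` kept w A"
    then obtain j where j: "j \<in> kept w A" and R: "R = route_of s (take j w)" by blast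
    have jl: "j \<le> length w" using j by (simp add: kept_def)
    consider "j = 0" | "j = length w" "0 < j" | i where "j = Suc i" "Suc i < length w"
      using jl by (metis gr0_implies_Suc le_neq_implies_less neq0_conv)
    then show "R \<in> C"
    proof cases
      case 1
      show ?thesis
      proof (cases "w = []")
        case True
        have "(Suc n, 1) \<in> arcs (oruga s)" using part_last by (simp add: arcs_oruga_iff)
        then obtain Q where "Q \<in> C" using cov by (auto simp: covering_def)
        then show ?thesis using in_Delta True R by auto
      next
        case False
        then have l: "0 < length w" by simp
        \<comment> \<open>Only the empty prefix lacks the first letter.\<close>
        obtain k where k: "k \<le> length w" "route_of s (take k w) \<in> C" "count_list (take k w) (w ! 0) = 0"
          using covers[of "w ! 0" 0] stirling_nth[OF w l] by auto
        have "\<not> Suc 0 \<le> k" using count_list_take_mono[of "Suc 0" k w "w ! 0"] k(3) l by (auto simp: count_list_take_Suc)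
        then have "k = 0" by simp
        then show ?thesis using k R 1 by simp
      qed
    next
      case 2
      then have l: "length w - 1 < length w" by simp
      let ?x = "w ! (length w - 1)"
      have x: "1 \<le> ?x" "?x \<le> n" using stirling_nth[OF w l] by auto
      \<comment> \<open>Only the whole word has all copies of its last letter.\<close>
      obtain k where k: "k \<le> length w" "route_of s (take k w) \<in> C" "count_list (take k w) ?x = part s ?x"
        using covers[OF x] by auto
      have "\<not> k \<le> length w - 1"
        using count_list_take_mono[of k "length w - 1" w ?x] count_list_take_less[OF l] k(3) stirling_count[OF w x] by auto
      then have "k = length w" using k(1) by simp
      then show ?thesis using k 2 R by simp
    next
      case (3 i)
      let ?x = "w ! i" and ?y = "w ! Suc i"
      have il: "i < length w" using 3 by simp
      have x: "1 \<le> ?x" "?x \<le> n" and y: "1 \<le> ?y" "?y \<le> n"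
        using stirling_nth[OF w il] stirling_nth[OF w 3(2)] by auto
      \<comment> \<open>The count of the letter before the position bounds k from below; in
        \<open>le\<close>, the count of the letter after it bounds k from above.\<close>
      have ge: "Suc i \<le> k" if "count_list (take k w) ?x = count_list (take (Suc i) w) ?x" for k
      proof (rule ccontr)
        assume "\<not> Suc i \<le> k"
        then have "count_list (take k w) ?x \<le> count_list (take i w) ?x" by (intro count_list_take_mono) simp
        then show False using that il by (simp add: count_list_take_Suc)
      qed
      have le: "k \<le> Suc i" if "count_list (take k w) ?y = count_list (take (Suc i) w) ?y" for k
      proof (rule ccontr)
        assume "\<not> k \<le> Suc i"
        then have "count_list (take (Suc (Suc i)) w) ?y \<le> count_list (take k w) ?y"
          by (intro count_list_take_mono) simp
        then show False using that count_list_take_Suc[OF 3(2), of ?y] by simp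
      qed
      consider "?x < ?y" | "?x = ?y" | "?y < ?x" by linarith
      then show ?thesis
      proof cases
        case 1
        then have "(?x, ?y) \<notin> A" using j 3 by (auto simp: kept_def)
        then show ?thesis using 1 3 R by (auto simp: A_def)
      next
        case 2
        have "count_list (take (Suc i) w) ?x \<le> part s ?x"
          using count_list_take_le[of "Suc i" w ?x] stirling_count[OF w x] by simp
        then obtain k where k: "route_of s (take k w) \<in> C" "count_list (take k w) ?x = count_list (take (Suc i) w) ?x"
          using covers[OF x] by blast
        then have "k = Suc i" using ge[of k] le[of k] 2 by simp
        then show ?thesis using k(1) R 3 by simp
      next
        \<comment> \<open>At a descent the smaller letter y has not begun: it is not partly used,
          and a copy is still to come. The count of x is its inversion number over y, so a route
          attaining \<open>lower C\<close> there has both required labels.\<close>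
        case yx: 3
        have "?x \<le> route_level s (take (Suc i) w)" using letter_le_route_level(2)[OF w il] .
        then have "\<not> (0 < count_list (take (Suc i) w) ?y \<and> count_list (take (Suc i) w) ?y < part s ?y)"
          using le_route_level_iff[of ?x "take (Suc i) w"] x y yx by simp
        moreover have lt: "count_list (take (Suc i) w) ?y < count_list w ?y"
          using 3 by (intro count_list_take_less) auto
        ultimately have y0: "count_list (take (Suc i) w) ?y = 0" using stirling_count[OF w y] by simp
        have "count_list (take (Suc i) w) ?x = inversions w ?x ?y"
          using count_eq_inversions(1)[OF av yx 3(2)] by simp
        also have "\<dots> = lower C ?x ?y" using inv[of ?y ?x] x y yx by simp
        finally have eq: "count_list (take (Suc i) w) ?x = lower C ?x ?y" .
        have pos: "0 < lower C ?x ?y" unfolding eq[symmetric] using il by (simp add: count_list_take_Suc)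
        obtain Q where Q: "Q \<in> C" "(?x, lower C ?x ?y) \<in> set Q" "(?y, 0) \<in> set Q"
          by (rule lower_cases[OF sub, of ?x ?y]) (use pos in auto)
        obtain k where k: "Q = route_of s (take k w)" using in_Delta[OF Q(1)] by blast
        have "count_list (take k w) ?x = count_list (take (Suc i) w) ?x"
          using Q(2) unfolding k eq mem_route_of_letter[OF x(2)] by simp
        moreover have "count_list (take k w) ?y = count_list (take (Suc i) w) ?y"
          using Q(3) unfolding k y0 mem_route_of_letter[OF y(2)] by simp
        ultimately have "Suc i \<le> k" "k \<le> Suc i" using ge le by blast+
        then have "k = Suc i" by simp
        then show ?thesis using Q(1) k R 3 by simp
      qed
    qed
  qed
  then have "C = Delta_face s (w, A)" unfolding Delta_face_eq[OF F] .
  with F that show ?thesis by blast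
qed

text \<open>The word is recovered from \<open>lower\<close>, and A from the ascents whose prefix
  routes are absent.\<close>

lemma inj_on_Delta_face: "inj_on (Delta_face s) (perm_faces s)"
proof (rule inj_onI)
  fix F F' assume "F \<in> perm_faces s" "F' \<in> perm_faces s" and eq: "Delta_face s F = Delta_face s F'"
  moreover obtain w A w' A' where FF: "F = (w, A)" "F' = (w', A')" by fastforce
  ultimately have F: "(w, A) \<in> perm_faces s" and F': "(w', A') \<in> perm_faces s"
    and eq: "Delta_face s (w, A) = Delta_face s (w', A')" by auto
  have "w = w'"
  proof (rule stirling_inversions_inject)
    show "inversions w c a = inversions w' c a" if "1 \<le> a" "a < c" "c \<le> n" for a c
      using lower_Delta_face[OF F that] lower_Delta_face[OF F' that] eq by simp
  qed (use perm_facesD(1) F F' in auto)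
  have sub: "A1 \<subseteq> A2" if F1: "(w, A1) \<in> perm_faces s" and F2: "(w, A2) \<in> perm_faces s"
    and eq: "Delta_face s (w, A1) = Delta_face s (w, A2)" for A1 A2
  proof clarify
    fix a c assume ac: "(a, c) \<in> A1"
    obtain i where i: "Suc i < length w" "w ! i = a" "w ! Suc i = c" using perm_facesD(4)[OF F1 ac] by blast
    have lt: "w ! i < w ! Suc i" using perm_facesD(3)[OF F1 ac] i by simp
    have "route_of s (take (Suc i) w) \<notin> Delta_word s (transposition w a c)"
      using route_of_take_in_Delta_transposition_iff[OF perm_facesD(1)[OF F1] i(1) lt, of "Suc i"] i by simp
    then have "route_of s (take (Suc i) w) \<notin> Delta_face s (w, A1)" using ac by (auto simp: Delta_face_def)
    then have "Suc i \<notin> kept w A2" unfolding eq Delta_face_eq[OF F2] by blast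
    then show "(a, c) \<in> A2" using i by (auto simp: kept_def)
  qed
  have "A = A'" using sub[of A A'] sub[of A' A] F F' eq \<open>w = w'\<close> by auto
  then show "F = F'" using FF \<open>w = w'\<close> by simp
qed

text \<open>Shrinking a clique lowers \<open>lower\<close> and raises \<open>upper\<close>.
  Conversely, the inequalities place each route of the second clique among the prefix routes of w,
  and not among the dropped ones, since \<open>upper\<close> exceeds the inversion number at ascents
  in A.\<close>

lemma Delta_face_subset_iff:
  assumes F: "(w, A) \<in> perm_faces s" and F': "(w', A') \<in> perm_faces s"
  shows "Delta_face s (w', A') \<subseteq> Delta_face s (w, A) \<longleftrightarrow>
    (\<forall>a c. 1 \<le> a \<and> a < c \<and> c \<le> n \<longrightarrow> inversions w' c a \<le> inversions w c a \<and>
      upper (Delta_face s (w, A)) c a \<le> upper (Delta_face s (w', A')) c a)"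
    (is "?C' \<subseteq> ?C \<longleftrightarrow> ?le")
proof
  have sub: "?C \<subseteq> routes s" and sub': "?C' \<subseteq> routes s"
    using clique_Delta_face F F' by (auto simp: clique_def)
  {
    assume CC: "?C' \<subseteq> ?C"
    show ?le
    proof (intro allI impI conjI; elim conjE)
      fix a c assume ac: "1 \<le> a" "a < c" "c \<le> n"
      have "lower ?C' c a \<le> lower ?C c a"
        by (rule lower_cases[OF sub', of c a]) (use CC le_lower[OF sub] in auto)
      then show "inversions w' c a \<le> inversions w c a"
        using lower_Delta_face[OF F ac] lower_Delta_face[OF F' ac] by simp
      show "upper ?C c a \<le> upper ?C' c a"
        by (rule upper_cases[OF sub', of c a]) (use CC upper_le[OF sub] upper_le_part[OF sub] in auto)
    qed
  next
    assume le: ?le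
    note w = perm_facesD(1)[OF F] and av = stirling_avoids[OF perm_facesD(1)[OF F]]
    show "?C' \<subseteq> ?C"
    proof
      fix R assume R: "R \<in> ?C'"
      have inv_le_upper: "inversions w c a \<le> upper ?C c a" if "1 \<le> a" "a < c" "c \<le> n" for a c
        using upper_Delta_face_ge[OF F that] by simp
      have "R \<in> Delta_word s w"
      proof (subst mem_Delta_word_iff[OF w])
        show "R \<in> routes s" using R sub' by blast
        show "\<forall>a c x. 1 \<le> a \<and> a < c \<and> c \<le> n \<and> (c, x) \<in> set R \<longrightarrow>
          ((a, 0) \<in> set R \<longrightarrow> x \<le> inversions w c a) \<and>
          ((a, part s a) \<in> set R \<longrightarrow> inversions w c a \<le> x)"
        proof (intro allI impI conjI; elim conjE)
          fix a c x assume ac: "1 \<le> a" "a < c" "c \<le> n" "(c, x) \<in> set R"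
          show "x \<le> inversions w c a" if "(a, 0) \<in> set R"
            using le_lower[OF sub' R ac(4) that] lower_Delta_face[OF F' ac(1-3)] le ac by fastforce
          show "inversions w c a \<le> x" if "(a, part s a) \<in> set R"
            using upper_le[OF sub' R ac(4) that] inv_le_upper[OF ac(1-3)] le ac by fastforce
        qed
      qed
      then obtain j where j: "j \<le> length w" "R = route_of s (take j w)"
        using w by (auto simp: Delta_word_eq length_stirling)
      have "(w ! i, w ! Suc i) \<notin> A" if i: "j = Suc i" "Suc i < length w" for i
      proof
        assume A: "(w ! i, w ! Suc i) \<in> A"
        define a c where "a = w ! i" and "c = w ! Suc i"
        have lt: "w ! i < w ! Suc i" using perm_facesD(3)[OF F A] .
        have il: "i < length w" using i by simp
        have ac: "1 \<le> a" "a < c" "c \<le> n"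
          using lt stirling_nth[OF w il] stirling_nth[OF w i(2)] by (auto simp: a_def c_def)
        have "count_list (take j w) a = part s a"
          using count_list_take_ascent[OF av i(2) lt] stirling_count[OF w, of a] ac i by (simp add: a_def)
        then have "(a, part s a) \<in> set R" "(c, count_list (take j w) c) \<in> set R"
          using letter_le_route_level(2)[OF w il] letter_le_route_level(1)[OF w i(2)] i j ac
          by (auto simp: mem_route_of_letter a_def c_def)
        then have "upper ?C' c a \<le> count_list (take j w) c" using upper_le[OF sub' R] by blast
        also have "\<dots> = inversions w c a"
          using count_eq_inversions(2)[OF av ac(2) il] i by (simp add: a_def)
        also have "\<dots> < upper ?C c a" using upper_Delta_face_ge[OF F ac] A by (simp add: a_def c_def)
        finally show False using le ac by fastforce
      qed
      then have "j \<in> kept w A" using j by (auto simp: kept_def)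
      then show "R \<in> ?C" unfolding Delta_face_eq[OF F] using j by blast
    qed
  }
qed

lemma weak_le_iff:
  assumes "w \<in> stirling s" "w' \<in> stirling s"
  shows "weak_le s w w' \<longleftrightarrow>
    (\<forall>a c. 1 \<le> a \<and> a < c \<and> c \<le> n \<longrightarrow> inversions w c a \<le> inversions w' c a)"
  using assms unfolding weak_le_def by (auto simp: stirling_inv_num)

text \<open>Inclusion of intervals is a comparison of endpoints, because w lies below w + A and so
  each interval contains both of its endpoints.\<close>

lemma face_le_iff:
  assumes F: "F \<in> perm_faces s" and F': "F' \<in> perm_faces s"
  shows "face_le s F F' \<longleftrightarrow> Delta_face s F' \<subseteq> Delta_face s F"
proof -
  obtain w A w' A' where FF: "F = (w, A)" "F' = (w', A')" by fastforce
  note F = F[unfolded FF] and F' = F'[unfolded FF]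
  define z z' where "z = add_ascents s w A" and "z' = add_ascents s w' A'"
  note w = perm_facesD(1)[OF F] and w' = perm_facesD(1)[OF F']
  have z: "z \<in> stirling s" and z': "z' \<in> stirling s"
    and zi: "\<And>a c. 1 \<le> a \<Longrightarrow> a < c \<Longrightarrow> c \<le> n \<Longrightarrow> inversions z c a = upper (Delta_face s (w, A)) c a"
    and zi': "\<And>a c. 1 \<le> a \<Longrightarrow> a < c \<Longrightarrow> c \<le> n \<Longrightarrow> inversions z' c a = upper (Delta_face s (w', A')) c a"
    using add_ascents_stirling[OF F] add_ascents_stirling[OF F'] by (auto simp: z_def z'_def)
  have wz: "weak_le s w z"
    unfolding weak_le_iff[OF w z] using zi upper_Delta_face_ge[OF F] by (metis add_leD1)
  have refl: "weak_le s x x" for x by (simp add: weak_le_def)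
  have trans: "weak_le s x y \<Longrightarrow> weak_le s y x' \<Longrightarrow> weak_le s x x'" for x y x'
    unfolding weak_le_def by (meson order.trans)
  have "face_le s F F' \<longleftrightarrow> weak_interval s w z \<subseteq> weak_interval s w' z'"
    by (simp add: face_le_def FF z_def z'_def)
  also have "\<dots> \<longleftrightarrow> weak_le s w' w \<and> weak_le s z z'"
  proof
    assume "weak_interval s w z \<subseteq> weak_interval s w' z'"
    moreover have "w \<in> weak_interval s w z" "z \<in> weak_interval s w z"
      using w z wz refl by (auto simp: weak_interval_def)
    ultimately show "weak_le s w' w \<and> weak_le s z z'" by (auto simp: weak_interval_def)
  next
    assume "weak_le s w' w \<and> weak_le s z z'"
    then show "weak_interval s w z \<subseteq> weak_interval s w' z'"
      unfolding weak_interval_def using trans by blast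
  qed
  also have "\<dots> \<longleftrightarrow> Delta_face s (w', A') \<subseteq> Delta_face s (w, A)"
    unfolding Delta_face_subset_iff[OF F F'] weak_le_iff[OF w' w] weak_le_iff[OF z z']
    using zi zi' by auto
  finally show ?thesis by (simp add: FF)
qed

lemma bij_betw_faces:
  "bij_betw (\<lambda>F. route_simplex (Delta_face s F)) (perm_faces s) (interior_simplices s)"
proof -
  have "Delta_face s ` perm_faces s = {C. clique s C \<and> covering C}"
    using clique_Delta_face covering_Delta_face covering_clique_is_face by (auto simp: image_iff) metis
  then have 1: "bij_betw (Delta_face s) (perm_faces s) {C. clique s C \<and> covering C}"
    using inj_on_Delta_face by (simp add: bij_betw_def)
  have "inj_on route_simplex {C. clique s C \<and> covering C}"
    using route_simplex_subset_iff by (intro inj_onI) (auto simp: clique_def)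
  then have 2: "bij_betw route_simplex {C. clique s C \<and> covering C} (interior_simplices s)"
    by (simp add: bij_betw_def interior_simplices_eq)
  from bij_betw_trans[OF 1 2] show ?thesis by (simp add: comp_def)
qed

end

theorem theorem3p18:
  fixes s :: "nat list"
  assumes "composition s"
  shows "(\<forall>F\<in>perm_faces s. clique s (Delta_face s F)) \<and>
    bij_betw (\<lambda>F. route_simplex (Delta_face s F)) (perm_faces s) (interior_simplices s) \<and>
    (\<forall>F\<in>perm_faces s. \<forall>F'\<in>perm_faces s.
       face_le s F F' \<longleftrightarrow>
       route_simplex (Delta_face s F) \<supseteq> route_simplex (Delta_face s F'))"
proof -
  interpret oruga_graph s using assms by unfold_locales
  have "face_le s F F' \<longleftrightarrow> route_simplex (Delta_face s F') \<subseteq> route_simplex (Delta_face s F)"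
    if "F \<in> perm_faces s" "F' \<in> perm_faces s" for F F'
    using face_le_iff[OF that] route_simplex_subset_iff clique_Delta_face that by (simp add: clique_def)
  then show ?thesis using clique_Delta_face bij_betw_faces by blast
qed

end
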